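(* Let $\Omega=(-1,1)^2$ and let $h_0$ be the solution (bounded, and continuous up to the open sides of the square) of $$\Delta h_0=-\frac{1}{6}(q_{0,yy}-q_{0,xx})\quad\text{in }\Omega,\qquad h_0=0\quad\text{on }\partial\Omega\ (\text{away from the corners}),$$ with $q_0$ the function given in the context. Then $$h_0(x,y)=\sum_{m,n\ \mathrm{odd}}\frac{16s_+mn}{3\pi^2(m^2+n^2)^2}\sin\Big(\frac{m\pi(x+1)}{2}\Big)\sin\Big(\frac{n\pi(y+1)}{2}\Big),$$ where the sum is over positive odd integers $m,n$, and $h_0(0,0)$ is positive.
   Context: $s_+>0$ is a fixed constant. The function $q_0$ is the harmonic function on the square $(-1,1)^2$ with boundary values $s_+/2$ on the sides $y=\pm1$ and $-s_+/2$ on the sides $x=\pm1$, given explicitly by \begin{align*} q_0(x,y)=\frac{s_+}{2}\sum_{k\ \mathrm{odd}}\frac{4}{k\pi}\Big(&\sin\Big(\frac{k\pi(x+1)}{2}\Big)\frac{\sinh(k\pi(1-y)/2)+\sinh(k\pi(1+y)/2)}{\sinh(k\pi)}\\&-\sin\Big(\frac{k\pi(y+1)}{2}\Big)\frac{\sinh(k\pi(1-x)/2)+\sinh(k\pi(1+x)/2)}{\sinh(k\pi)}\Big), \end{align*} the sum being over positive odd integers $k$. Subscripts after a comma denote partial derivatives. *)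

theory Defs
  imports "HOL-Analysis.Analysis"
begin

definition Omega :: "(real \<times> real) set" where
  "Omega = {-1<..<1} \<times> {-1<..<1}"

definition corners :: "(real \<times> real) set" where
  "corners = {-1, 1} \<times> {-1, 1}"

definition dx :: "(real \<times> real \<Rightarrow> real) \<Rightarrow> real \<times> real \<Rightarrow> real" where
  "dx f = (\<lambda>(x, y). deriv (\<lambda>t. f (t, y)) x)"

definition dy :: "(real \<times> real \<Rightarrow> real) \<Rightarrow> real \<times> real \<Rightarrow> real" where
  "dy f = (\<lambda>(x, y). deriv (\<lambda>t. f (x, t)) y)"

definition laplacian :: "(real \<times> real \<Rightarrow> real) \<Rightarrow> real \<times> real \<Rightarrow> real" where
  "laplacian f p = dx (dx f) p + dy (dy f) p"

text \<open>
  Used only for open \<open>U\<close>.  Since \<^const>\<open>deriv\<close> is total, the existence of the partial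
  derivatives has to be required separately from their continuity.
\<close>

definition C1_on :: "(real \<times> real) set \<Rightarrow> (real \<times> real \<Rightarrow> real) \<Rightarrow> bool" where
  "C1_on U f \<longleftrightarrow>
     (\<forall>(x, y) \<in> U. (\<lambda>t. f (t, y)) differentiable (at x) \<and> (\<lambda>t. f (x, t)) differentiable (at y))
     \<and> continuous_on U (dx f) \<and> continuous_on U (dy f)"

definition C2_on :: "(real \<times> real) set \<Rightarrow> (real \<times> real \<Rightarrow> real) \<Rightarrow> bool" where
  "C2_on U f \<longleftrightarrow> C1_on U f \<and> C1_on U (dx f) \<and> C1_on U (dy f)"

text \<open>
  The index \<open>j\<close> stands for the odd number \<open>k = 2 j + 1\<close>.  The series converges absolutely
  at every point of \<^const>\<open>Omega\<close>, the only place where \<open>q0\<close> is used.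
\<close>

definition q0 :: "real \<Rightarrow> real \<times> real \<Rightarrow> real" where
  "q0 s = (\<lambda>(x, y). s / 2 * (\<Sum>j. let k = real (2 * j + 1) in
      4 / (k * pi) *
        (sin (k * pi * (x + 1) / 2)
           * ((sinh (k * pi * (1 - y) / 2) + sinh (k * pi * (1 + y) / 2)) / sinh (k * pi))
         - sin (k * pi * (y + 1) / 2)
           * ((sinh (k * pi * (1 - x) / 2) + sinh (k * pi * (1 + x) / 2)) / sinh (k * pi)))))"

definition is_h0 :: "real \<Rightarrow> (real \<times> real \<Rightarrow> real) \<Rightarrow> bool" where
  "is_h0 s h \<longleftrightarrow>
     C2_on Omega h
     \<and> (\<forall>p \<in> Omega. laplacian h p = - (1 / 6) * (dy (dy (q0 s)) p - dx (dx (q0 s)) p))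
     \<and> bounded (h ` Omega)
     \<and> continuous_on (closure Omega - corners) h
     \<and> (\<forall>p \<in> frontier Omega - corners. h p = 0)"

text \<open>
  Convergence of a double series in the sense of Pringsheim: the rectangular partial sums
  converge as both bounds tend to infinity independently.  The unordered sum \<^const>\<open>has_sum\<close>
  would not do for the double sine series of \<open>h\<^sub>0\<close>: at the origin, for instance, the absolute
  values of its terms are a constant times \<open>m n / (m\<^sup>2 + n\<^sup>2)\<^sup>2\<close>, whose sum is infinite.
\<close>

definition double_sums :: "(nat \<Rightarrow> nat \<Rightarrow> real) \<Rightarrow> real \<Rightarrow> bool" where
  "double_sums a l \<longleftrightarrow>
     ((\<lambda>(M, N). \<Sum>i<M. \<Sum>j<N. a i j) \<longlongrightarrow> l) (sequentially \<times>\<^sub>F sequentially)"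

definition h0_term :: "real \<Rightarrow> real \<Rightarrow> real \<Rightarrow> nat \<Rightarrow> nat \<Rightarrow> real" where
  "h0_term s x y m n =
     16 * s * real m * real n / (3 * pi\<^sup>2 * ((real m)\<^sup>2 + (real n)\<^sup>2)\<^sup>2)
       * sin (real m * pi * (x + 1) / 2) * sin (real n * pi * (y + 1) / 2)"

end

theory Submission
  imports Defs
begin

text \<open>
  Write \<open>a\<^sub>j = (2 j + 1) \<pi> / 2\<close> and \<open>S\<^sub>j(x) = sin (a\<^sub>j (x + 1))\<close>. The function \<open>q0\<close> is \<open>s / 2\<close>
  times \<open>U(x, y) - U(y, x)\<close>, where \<open>U = \<Sum>\<^sub>j (2 / a\<^sub>j) S\<^sub>j(x) cosh (a\<^sub>j y) / cosh a\<^sub>j\<close> is harmonic.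
  Because \<open>U\<close> is harmonic, the right-hand side of the equation for \<open>h\<^sub>0\<close> is a symmetric sum of multiples of
  \<open>U\<^sub>y\<^sub>y(x, y)\<close> and \<open>U\<^sub>y\<^sub>y(y, x)\<close>, and the equation can be solved mode by mode: it reduces to
  \<open>w'' - a\<^sup>2 w = - 2 a cosh (a y) / cosh a\<close> with \<open>w(1) = w(-1) = 0\<close>, whose solution is the elementary function
  \<open>w\<^sub>j(y) = (tanh a\<^sub>j cosh (a\<^sub>j y) - y sinh (a\<^sub>j y)) / cosh a\<^sub>j\<close>. With \<open>F = \<Sum>\<^sub>j S\<^sub>j(x) w\<^sub>j(y)\<close> the solution is
  \<open>h\<^sub>0(x, y) = (s / 6) (F(x, y) + F(y, x))\<close>.

  Inside the square all these series converge exponentially fast together with all their derivatives, which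
  gives the differential equation (\<open>solution_C2_and_laplacian\<close>). Near the sides \<open>y = 1\<close> and \<open>y = -1\<close> the decay is
  lost. There \<open>w\<^sub>j(y)\<close> is compared with \<open>t exp (- a\<^sub>j t)\<close>, where \<open>t = 1 - \<bar>y\<bar>\<close>; the error is \<open>t\<close> times a summable
  sequence, and \<open>\<Sum>\<^sub>j exp (- a\<^sub>j t) S\<^sub>j(x)\<close> is at most of order \<open>1 / t\<close> everywhere and stays bounded as long as
  \<open>x\<close> stays away from \<open>1\<close> and \<open>-1\<close>. So \<open>F\<close> is bounded and tends to zero on the open sides
  (\<open>half_solution_bounds\<close>), and hence \<open>h\<^sub>0\<close> exists (\<open>is_h0_solution\<close>).

  Uniqueness (\<open>is_h0_unique\<close>) is a maximum principle of Phragmen-Lindelof type. The boundary condition says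
  nothing at the corners, but the logarithmic potentials of the four corners are harmonic and become infinite
  there, so that an arbitrarily small multiple of them dominates any bounded function near them
  (\<open>bounded_harmonic_nonpos\<close>).

  For the series, each profile is expanded in sines,
  \<open>w\<^sub>j(y) = \<Sum>\<^sub>l c\<^sub>j\<^sub>l S\<^sub>l(y)\<close> with \<open>c\<^sub>j\<^sub>l = 4 a\<^sub>j a\<^sub>l / (a\<^sub>j\<^sup>2 + a\<^sub>l\<^sup>2)\<^sup>2\<close> (\<open>profile_sine_expansion\<close>); a continuous
  function orthogonal to all sines vanishes, by the Stone-Weierstrass theorem. So \<open>F\<close> is the iterated sum of
  \<open>c\<^sub>j\<^sub>l S\<^sub>j(x) S\<^sub>l(y)\<close>, taken over \<open>l\<close> first. The rectangular partial sums have the same limit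
  (\<open>rectangular_sums_tendsto\<close>): summation by parts bounds the tail of row \<open>j\<close> from column \<open>N\<close> on by the variation
  \<open>\<Sum>\<^sub>l\<^sub>\<ge>\<^sub>N \<bar>c\<^sub>j\<^sub>l - c\<^sub>j\<^sub>,\<^sub>l\<^sub>+\<^sub>1\<bar>\<close>, and unlike the \<open>c\<^sub>j\<^sub>l\<close> themselves these differences are absolutely summable over both
  indices. Since \<open>c\<^sub>j\<^sub>l\<close> is symmetric, the same double series converges to \<open>F(y, x)\<close> as well, and adding the two
  limits gives the claim; the coefficients in the theorem are \<open>s c\<^sub>j\<^sub>l / 3\<close>.

  At the origin \<open>F = \<Sum>\<^sub>j (-1)\<^sup>j tanh a\<^sub>j / cosh a\<^sub>j\<close> is an alternating series with decreasing terms, so it is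
  positive (\<open>solution_origin_pos\<close>).
\<close>

section \<open>Partial derivatives\<close>

text \<open>
  Naming the partial derivatives explicitly, instead of working with \<^const>\<open>dx\<close> and \<^const>\<open>dy\<close>, makes them
  compose under sums, reflections and termwise differentiation.
\<close>

definition has_partials_on ::
  "(real \<times> real) set \<Rightarrow> (real \<times> real \<Rightarrow> real) \<Rightarrow> (real \<times> real \<Rightarrow> real) \<Rightarrow> (real \<times> real \<Rightarrow> real) \<Rightarrow> bool"
where
  "has_partials_on U f fx fy \<longleftrightarrow>
     (\<forall>(x, y) \<in> U. ((\<lambda>t. f (t, y)) has_real_derivative fx (x, y)) (at x)
                   \<and> ((\<lambda>t. f (x, t)) has_real_derivative fy (x, y)) (at y))"

lemma has_partials_onD:
  assumes "has_partials_on U f fx fy" "(x, y) \<in> U"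
  shows "((\<lambda>t. f (t, y)) has_real_derivative fx (x, y)) (at x)"
    and "((\<lambda>t. f (x, t)) has_real_derivative fy (x, y)) (at y)"
  using assms by (auto simp: has_partials_on_def)

lemma has_partials_on_imp_dx_dy:
  assumes "has_partials_on U f fx fy" "p \<in> U"
  shows "dx f p = fx p" "dy f p = fy p"
  using assms by (auto simp: dx_def dy_def has_partials_on_def intro!: DERIV_imp_deriv)

lemma open_slices:
  fixes U :: "(real \<times> real) set"
  assumes "open U"
  shows "open {t. (t, y) \<in> U}" "open {t. (x, t) \<in> U}"
proof -
  have "open ((\<lambda>t. (t, y)) -` U)" "open ((\<lambda>t. (x, t)) -` U)"
    by (intro open_vimage assms continuous_intros)+
  then show "open {t. (t, y) \<in> U}" "open {t. (x, t) \<in> U}"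
    by (simp_all add: vimage_def)
qed

lemma has_partials_on_cong:
  assumes U: "open U" and hp: "has_partials_on U f fx fy" and eq: "\<And>p. p \<in> U \<Longrightarrow> g p = f p"
  shows "has_partials_on U g fx fy"
  unfolding has_partials_on_def
proof clarify
  fix x y assume p: "(x, y) \<in> U"
  note D = has_partials_onD[OF hp p]
  show "((\<lambda>t. g (t, y)) has_real_derivative fx (x, y)) (at x) \<and>
        ((\<lambda>t. g (x, t)) has_real_derivative fy (x, y)) (at y)"
    using has_field_derivative_transform_within_open[OF D(1) open_slices(1)[OF U], of y "\<lambda>t. g (t, y)"]
      has_field_derivative_transform_within_open[OF D(2) open_slices(2)[OF U], of x "\<lambda>t. g (x, t)"]
      p eq by auto
qed

text \<open>
  Reflection in the diagonal exchanges the roles of the two variables; the solution and \<open>q0\<close> are both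
  symmetrized in this way.
\<close>

lemma has_partials_on_swap:
  assumes "has_partials_on U f fx fy"
  shows "has_partials_on (prod.swap ` U) (\<lambda>(x, y). f (y, x)) (\<lambda>(x, y). fy (y, x)) (\<lambda>(x, y). fx (y, x))"
  using assms by (auto simp: has_partials_on_def)

lemma has_partials_on_lincomb:
  assumes "has_partials_on U f fx fy" "has_partials_on U g gx gy"
  shows "has_partials_on U (\<lambda>p. c * (f p + b * g p)) (\<lambda>p. c * (fx p + b * gx p)) (\<lambda>p. c * (fy p + b * gy p))"
  using assms unfolding has_partials_on_def
  by (auto intro!: derivative_eq_intros)

lemma C2_onD:
  assumes "C2_on U f"
  shows "has_partials_on U f (dx f) (dy f)"
    and "has_partials_on U (dx f) (dx (dx f)) (dy (dx f))"
    and "has_partials_on U (dy f) (dx (dy f)) (dy (dy f))"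
proof -
  have "has_partials_on U g (dx g) (dy g)" if "C1_on U g" for g
    using that unfolding C1_on_def has_partials_on_def dx_def dy_def
    by (auto simp: differentiable_def real_differentiable_def DERIV_deriv_iff_real_differentiable)
  then show "has_partials_on U f (dx f) (dy f)"
    "has_partials_on U (dx f) (dx (dx f)) (dy (dx f))"
    "has_partials_on U (dy f) (dx (dy f)) (dy (dy f))"
    using assms by (auto simp: C2_on_def)
qed

lemma C1_onI:
  assumes hp: "has_partials_on U f fx fy" and cont: "continuous_on U fx" "continuous_on U fy"
  shows "C1_on U f"
  unfolding C1_on_def
proof (intro conjI)
  show "\<forall>(x, y)\<in>U. (\<lambda>t. f (t, y)) differentiable at x \<and> (\<lambda>t. f (x, t)) differentiable at y"
    using hp by (auto simp: has_partials_on_def real_differentiable_def)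
  show "continuous_on U (dx f)" "continuous_on U (dy f)"
    using cont has_partials_on_imp_dx_dy[OF hp] by (auto cong: continuous_on_cong)
qed

text \<open>
  \<^term>\<open>dx f\<close> agrees with \<open>fx\<close> on \<open>U\<close> only. That suffices to differentiate it again, because \<open>U\<close> is open.
\<close>

lemma second_partials:
  assumes U: "open U" and f: "has_partials_on U f fx fy"
    and fx: "has_partials_on U fx fxx fxy" and fy: "has_partials_on U fy fyx fyy"
  shows "has_partials_on U (dx f) fxx fxy" "has_partials_on U (dy f) fyx fyy"
    and "p \<in> U \<Longrightarrow> dx (dx f) p = fxx p" "p \<in> U \<Longrightarrow> dy (dy f) p = fyy p"
proof -
  show *: "has_partials_on U (dx f) fxx fxy" "has_partials_on U (dy f) fyx fyy"
    using has_partials_on_cong[OF U fx] has_partials_on_cong[OF U fy]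
      has_partials_on_imp_dx_dy[OF f] by auto
  show "p \<in> U \<Longrightarrow> dx (dx f) p = fxx p" "p \<in> U \<Longrightarrow> dy (dy f) p = fyy p"
    using has_partials_on_imp_dx_dy[OF *(1)] has_partials_on_imp_dx_dy[OF *(2)] by auto
qed

section \<open>Bounded harmonic functions that vanish on the sides\<close>

text \<open>
  Were the second derivative positive, the first derivative, which vanishes at the maximum, would be positive
  just to the right of it, and the mean value theorem would give larger values there.
\<close>

lemma local_max_second_deriv_nonpos:
  fixes f f' :: "real \<Rightarrow> real"
  assumes S: "open S" "x \<in> S"
    and f: "\<And>t. t \<in> S \<Longrightarrow> (f has_real_derivative f' t) (at t)"
    and f': "(f' has_real_derivative D) (at x)"
    and max: "\<And>t. t \<in> S \<Longrightarrow> f t \<le> f x"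
  shows "D \<le> 0"
proof (rule ccontr)
  assume "\<not> D \<le> 0"
  then obtain d where d: "d > 0" "\<And>h. 0 < h \<Longrightarrow> h < d \<Longrightarrow> f' x < f' (x + h)"
    using DERIV_pos_inc_right[OF f'] by auto
  obtain e where e: "e > 0" "\<And>t. \<bar>t - x\<bar> < e \<Longrightarrow> t \<in> S"
    using S by (auto simp: open_dist dist_real_def)
  have "f' x = 0"
    by (rule DERIV_local_max[OF f[OF S(2)] e(1)]) (use e max in \<open>auto simp: abs_minus_commute\<close>)
  define h where "h = min d e / 2"
  have h: "h > 0" "h < d" "h < e" using d e by (auto simp: h_def)
  have "\<And>t. x \<le> t \<Longrightarrow> t \<le> x + h \<Longrightarrow> (f has_real_derivative f' t) (at t)"
    using h by (intro f e) auto
  then obtain z where z: "x < z" "z < x + h" "f (x + h) - f x = (x + h - x) * f' z"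
    using MVT2[of x "x + h" f f'] h by auto
  have "f' z > 0" using d(2)[of "z - x"] z h \<open>f' x = 0\<close> by auto
  then have "f (x + h) > f x" using z h by (smt (verit) mult_pos_pos)
  moreover have "x + h \<in> S" using h by (intro e) auto
  ultimately show False using max by fastforce
qed

text \<open>
  The second derivative of \<open>ln ((x - a)\<^sup>2 + k)\<close>. With \<open>k = (y - b)\<^sup>2\<close> and the analogous expression in \<open>y\<close> the sum is
  zero, which is the harmonicity of the logarithmic potential.
\<close>

lemma DERIV_linear_over_square:
  fixes x a k :: real
  assumes "(x - a)\<^sup>2 + k \<noteq> 0"
  shows "((\<lambda>t. 2 * (t - a) / ((t - a)\<^sup>2 + k)) has_real_derivative
           2 / ((x - a)\<^sup>2 + k) - 4 * (x - a)\<^sup>2 / ((x - a)\<^sup>2 + k)\<^sup>2) (at x)"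
proof -
  define R where "R = (x - a)\<^sup>2 + k"
  have "((\<lambda>t. 2 * (t - a) / ((t - a)\<^sup>2 + k)) has_real_derivative
           (2 * R - 2 * (x - a) * (2 * (x - a))) / (R * R)) (at x)"
    using assms by (auto intro!: derivative_eq_intros simp: R_def)
  moreover have "(2 * R - 2 * (x - a) * (2 * (x - a))) / (R * R) = 2 / R - 4 * (x - a)\<^sup>2 / R\<^sup>2"
    using assms[folded R_def] by (simp add: diff_divide_distrib power2_eq_square) (simp add: algebra_simps)
  ultimately show ?thesis by (simp add: R_def)
qed

definition sqdist :: "real \<times> real \<Rightarrow> real \<times> real \<Rightarrow> real" where
  "sqdist c p = (fst p - fst c)\<^sup>2 + (snd p - snd c)\<^sup>2"

text \<open>
  A sum of logarithmic potentials, harmonic in the square and infinite at the corners. The squared distance of a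
  point of the square from a corner is at most \<open>8 < 9\<close>, so the normalization by \<open>ln 9\<close> makes it nonnegative.
\<close>

definition corner_barrier :: "real \<times> real \<Rightarrow> real" where
  "corner_barrier p = (\<Sum>c\<in>corners. ln 9 - ln (sqdist c p))"

lemma closure_Omega: "closure Omega = {-1..1} \<times> {-1..1}"
  by (simp add: Omega_def closure_Times)

lemma open_Omega: "open Omega"
  by (auto simp: Omega_def intro: open_Times)

lemma frontier_Omega: "frontier Omega = closure Omega - Omega"
  using open_Omega by (simp add: frontier_def interior_open)

lemma finite_corners: "finite corners"
  by (simp add: corners_def)

lemma corner_barrier_nonneg:
  assumes "p \<in> closure Omega - corners" "c \<in> corners"
  shows "0 < sqdist c p" "ln (sqdist c p) \<le> ln 9"
proof -
  obtain x y a b where p: "p = (x, y)" "c = (a, b)" by fastforce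
  have b: "\<bar>x\<bar> \<le> 1" "\<bar>y\<bar> \<le> 1" "\<bar>a\<bar> \<le> 1" "\<bar>b\<bar> \<le> 1" "p \<noteq> c"
    using assms p by (auto simp: closure_Omega corners_def)
  show "0 < sqdist c p"
    using b p by (auto simp: sqdist_def sum_power2_gt_zero_iff)
  have "\<bar>x - a\<bar> \<le> \<bar>2\<bar>" "\<bar>y - b\<bar> \<le> \<bar>2\<bar>" using b by linarith+
  then have "(x - a)\<^sup>2 \<le> 2\<^sup>2" "(y - b)\<^sup>2 \<le> 2\<^sup>2"
    by (simp_all only: abs_le_square_iff)
  then have "sqdist c p \<le> 9" by (simp add: p sqdist_def)
  then show "ln (sqdist c p) \<le> ln 9" using \<open>0 < sqdist c p\<close> by simp
qed

text \<open>
  Suppose \<open>d\<close> is positive at \<open>p0\<close>. Then so is \<open>\<phi> = d - \<epsilon> B + \<delta> x\<^sup>2\<close> with the barrier \<open>B\<close>, and even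
  \<open>\<phi> p0 > \<delta>\<close>, if \<open>\<epsilon>\<close> and \<open>\<delta>\<close> are small. On the sides, where \<open>d = 0\<close>, and near the corners, where \<open>\<epsilon> B\<close>
  exceeds the upper bound of \<open>d\<close>, one has \<open>\<phi> \<le> \<delta>\<close>. So \<open>\<phi>\<close> attains its maximum at an interior point, where both
  pure second derivatives are nonpositive; but their sum is \<open>2 \<delta> > 0\<close>.
\<close>

lemma bounded_harmonic_nonpos:
  assumes d: "has_partials_on Omega d d1 d2"
    and d1: "has_partials_on Omega d1 d11 d12" and d2: "has_partials_on Omega d2 d21 d22"
    and harm: "\<And>p. p \<in> Omega \<Longrightarrow> d11 p + d22 p = 0"
    and bdd: "\<And>p. p \<in> Omega \<Longrightarrow> d p \<le> M"
    and cont: "continuous_on (closure Omega - corners) d"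
    and bc: "\<And>p. p \<in> frontier Omega - corners \<Longrightarrow> d p = 0"
    and p0: "p0 \<in> Omega"
  shows "d p0 \<le> 0"
proof (rule ccontr)
  assume "\<not> d p0 \<le> 0"
  then have pos: "d p0 > 0" by simp
  have Omega_sub: "Omega \<subseteq> closure Omega - corners"
    by (auto simp: closure_Omega corners_def) (auto simp: Omega_def)
  define \<delta> where "\<delta> = d p0 / 4"
  define \<epsilon> where "\<epsilon> = d p0 / (4 * (corner_barrier p0 + 1))"
  define \<phi> where "\<phi> p = d p - \<epsilon> * corner_barrier p + \<delta> * (fst p)\<^sup>2" for p
  have Bnn: "corner_barrier p \<ge> 0" if "p \<in> closure Omega - corners" for p
    using corner_barrier_nonneg[OF that] by (auto simp: corner_barrier_def intro!: sum_nonneg)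
  have eps: "\<epsilon> > 0" and "\<epsilon> * corner_barrier p0 \<le> \<delta>"
    using pos Bnn[of p0] p0 Omega_sub by (auto simp: \<epsilon>_def \<delta>_def field_simps)
  then have phi0: "\<phi> p0 > \<delta>"
    using pos by (simp add: \<phi>_def \<delta>_def) (smt (verit) zero_le_power2 mult_nonneg_nonneg)
  have xsq: "\<delta> * (fst p)\<^sup>2 \<le> \<delta>" if "p \<in> closure Omega" for p
  proof -
    have "(fst p)\<^sup>2 \<le> 1" using that by (auto simp: closure_Omega abs_square_le_1)
    then show ?thesis using pos by (simp add: \<delta>_def)
  qed
  \<comment> \<open>within squared distance \<open>\<rho>\<close> of a corner, \<open>\<epsilon>\<close> times the barrier exceeds the bound \<open>M\<close>\<close>
  define \<rho> where "\<rho> = 9 * exp (- \<bar>M\<bar> / \<epsilon>)"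
  have "\<rho> > 0" by (simp add: \<rho>_def)
  have near: "\<phi> p \<le> \<delta>" if p: "p \<in> Omega" "c \<in> corners" "sqdist c p < \<rho>" for p c
  proof -
    have p': "p \<in> closure Omega - corners" using p Omega_sub by auto
    note cb = corner_barrier_nonneg[OF p']
    have "ln (sqdist c p) \<le> ln \<rho>" using cb(1)[OF p(2)] p(3) \<open>\<rho> > 0\<close> by simp
    also have "ln \<rho> = ln 9 - \<bar>M\<bar> / \<epsilon>" by (simp add: \<rho>_def ln_mult)
    finally have "\<bar>M\<bar> / \<epsilon> \<le> ln 9 - ln (sqdist c p)" by simp
    also have "\<dots> \<le> corner_barrier p"
      unfolding corner_barrier_def
      by (rule member_le_sum) (use p cb finite_corners in auto)
    finally have "\<bar>M\<bar> \<le> \<epsilon> * corner_barrier p" using eps by (simp add: field_simps)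
    then show ?thesis
      using bdd[OF p(1)] xsq[of p] p' by (auto simp: \<phi>_def)
  qed
  have edge: "\<phi> p \<le> \<delta>" if "p \<in> frontier Omega - corners" for p
  proof -
    have "p \<in> closure Omega - corners" using that by (simp add: frontier_Omega)
    then have "\<epsilon> * corner_barrier p \<ge> 0" using Bnn[of p] eps by simp
    then show ?thesis
      using bc[OF that] xsq[of p] \<open>p \<in> closure Omega - corners\<close> by (simp add: \<phi>_def)
  qed
  define K where "K = closure Omega \<inter> (\<Inter>c\<in>corners. {p. \<rho> \<le> sqdist c p})"
  have "compact K"
    unfolding K_def
  proof (intro compact_Int_closed closed_INT ballI)
    show "compact (closure Omega)" by (auto simp: closure_Omega intro: compact_Times)
    show "closed {p. \<rho> \<le> sqdist c p}" for c
      unfolding sqdist_def by (intro closed_Collect_le continuous_intros)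
  qed
  moreover have Ksub: "K \<subseteq> closure Omega - corners"
    using \<open>\<rho> > 0\<close> by (force simp: K_def sqdist_def)
  have "continuous_on K \<phi>"
    unfolding \<phi>_def corner_barrier_def
  proof (intro continuous_intros)
    show "continuous_on K d" using cont Ksub continuous_on_subset by blast
    show "continuous_on K (sqdist c)" for c unfolding sqdist_def by (intro continuous_intros)
    show "\<forall>p\<in>K. sqdist c p \<noteq> 0" if "c \<in> corners" for c
      using that \<open>\<rho> > 0\<close> by (force simp: K_def)
  qed
  moreover have p0K: "p0 \<in> K"
  proof (rule ccontr)
    assume "p0 \<notin> K"
    then obtain c where "c \<in> corners" "sqdist c p0 < \<rho>"
      using p0 Omega_sub by (auto simp: K_def not_le)
    from near[OF p0 this] phi0 show False by simp
  qed
  ultimately obtain p1 where p1: "p1 \<in> K" "\<And>p. p \<in> K \<Longrightarrow> \<phi> p \<le> \<phi> p1"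
    using continuous_attains_sup[of K \<phi>] by blast
  have phi1: "\<phi> p1 > \<delta>" using p1(2)[OF p0K] phi0 by simp
  have p1O: "p1 \<in> Omega"
    using edge[of p1] phi1 p1(1) Ksub by (auto simp: frontier_Omega)
  have max: "\<phi> p \<le> \<phi> p1" if "p \<in> Omega" for p
  proof (cases "p \<in> K")
    case False
    moreover have "p \<in> closure Omega" using that Omega_sub by blast
    ultimately obtain c where "c \<in> corners" "sqdist c p < \<rho>"
      unfolding K_def by (fastforce simp: not_le)
    from near[OF that this] phi1 show ?thesis by simp
  qed (use p1 in auto)
  obtain x1 y1 where p1_eq: "p1 = (x1, y1)" by fastforce
  define b_x where "b_x = (\<lambda>(x, y). \<Sum>c\<in>corners. 2 * (x - fst c) / sqdist c (x, y))"
  define b_y where "b_y = (\<lambda>(x, y). \<Sum>c\<in>corners. 2 * (y - snd c) / sqdist c (x, y))"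
  define b_xx where "b_xx = (\<lambda>(x, y). \<Sum>c\<in>corners. 2 / sqdist c (x, y) - 4 * (x - fst c)\<^sup>2 / (sqdist c (x, y))\<^sup>2)"
  define b_yy where "b_yy = (\<lambda>(x, y). \<Sum>c\<in>corners. 2 / sqdist c (x, y) - 4 * (y - snd c)\<^sup>2 / (sqdist c (x, y))\<^sup>2)"
  define phix where "phix p = d1 p + \<epsilon> * b_x p + 2 * \<delta> * fst p" for p
  define phiy where "phiy p = d2 p + \<epsilon> * b_y p" for p
  have sq0: "sqdist c (x, y) > 0" if "(x, y) \<in> Omega" "c \<in> corners" for x y c
    using corner_barrier_nonneg(1)[of "(x, y)" c] that Omega_sub by auto
  have Dx: "((\<lambda>t. \<phi> (t, y)) has_real_derivative phix (x, y)) (at x)"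
    and Dy: "((\<lambda>t. \<phi> (x, t)) has_real_derivative phiy (x, y)) (at y)"
    and Dxx: "((\<lambda>t. phix (t, y)) has_real_derivative d11 (x, y) + \<epsilon> * b_xx (x, y) + 2 * \<delta>) (at x)"
    and Dyy: "((\<lambda>t. phiy (x, t)) has_real_derivative d22 (x, y) + \<epsilon> * b_yy (x, y)) (at y)"
    if O: "(x, y) \<in> Omega" for x y
  proof -
    have sq: "(x - fst c)\<^sup>2 + (y - snd c)\<^sup>2 > 0" if "c \<in> corners" for c
      using sq0[OF O that] by (simp add: sqdist_def)
    have sqn: "(x - fst c)\<^sup>2 + (y - snd c)\<^sup>2 \<noteq> 0" if "c \<in> corners" for c
      using sq[OF that] by linarith
    have "((\<lambda>t. corner_barrier (t, y)) has_real_derivative - b_x (x, y)) (at x)"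
      unfolding corner_barrier_def b_x_def sqdist_def prod.case sum_negf[symmetric] fst_conv snd_conv
      by (rule DERIV_sum) (use sq in \<open>auto intro!: derivative_eq_intros simp: field_simps\<close>)
    then show "((\<lambda>t. \<phi> (t, y)) has_real_derivative phix (x, y)) (at x)"
      unfolding \<phi>_def phix_def
      by (auto intro!: derivative_eq_intros has_partials_onD[OF d O] simp: field_simps)
    have "((\<lambda>t. corner_barrier (x, t)) has_real_derivative - b_y (x, y)) (at y)"
      unfolding corner_barrier_def b_y_def sqdist_def prod.case sum_negf[symmetric] fst_conv snd_conv
      by (rule DERIV_sum) (use sq in \<open>auto intro!: derivative_eq_intros simp: field_simps\<close>)
    then show "((\<lambda>t. \<phi> (x, t)) has_real_derivative phiy (x, y)) (at y)"
      unfolding \<phi>_def phiy_def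
      by (auto intro!: derivative_eq_intros has_partials_onD[OF d O] simp: field_simps)
    have "((\<lambda>t. b_x (t, y)) has_real_derivative b_xx (x, y)) (at x)"
      unfolding b_x_def b_xx_def sqdist_def prod.case fst_conv snd_conv
    proof (rule DERIV_sum)
      fix c :: "real \<times> real" assume "c \<in> corners"
      from DERIV_linear_over_square[OF sqn[OF this]]
      show "((\<lambda>t. 2 * (t - fst c) / ((t - fst c)\<^sup>2 + (y - snd c)\<^sup>2)) has_real_derivative
          2 / ((x - fst c)\<^sup>2 + (y - snd c)\<^sup>2) - 4 * (x - fst c)\<^sup>2 / ((x - fst c)\<^sup>2 + (y - snd c)\<^sup>2)\<^sup>2) (at x)" .
    qed
    then show "((\<lambda>t. phix (t, y)) has_real_derivative d11 (x, y) + \<epsilon> * b_xx (x, y) + 2 * \<delta>) (at x)"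
      unfolding phix_def
      by (auto intro!: derivative_eq_intros has_partials_onD[OF d1 O] simp: field_simps)
    have "((\<lambda>t. b_y (x, t)) has_real_derivative b_yy (x, y)) (at y)"
      unfolding b_y_def b_yy_def sqdist_def prod.case fst_conv snd_conv
    proof (rule DERIV_sum)
      fix c :: "real \<times> real" assume "c \<in> corners"
      from DERIV_linear_over_square[of y "snd c" "(x - fst c)\<^sup>2"] sqn[OF this]
      show "((\<lambda>t. 2 * (t - snd c) / ((x - fst c)\<^sup>2 + (t - snd c)\<^sup>2)) has_real_derivative
          2 / ((x - fst c)\<^sup>2 + (y - snd c)\<^sup>2) - 4 * (y - snd c)\<^sup>2 / ((x - fst c)\<^sup>2 + (y - snd c)\<^sup>2)\<^sup>2) (at y)"
        by (simp add: add.commute)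
    qed
    then show "((\<lambda>t. phiy (x, t)) has_real_derivative d22 (x, y) + \<epsilon> * b_yy (x, y)) (at y)"
      unfolding phiy_def
      by (auto intro!: derivative_eq_intros has_partials_onD[OF d2 O] simp: field_simps)
  qed
  have O1: "(x1, y1) \<in> Omega" using p1O p1_eq by simp
  have "d11 (x1, y1) + \<epsilon> * b_xx (x1, y1) + 2 * \<delta> \<le> 0"
    by (rule local_max_second_deriv_nonpos[where f="\<lambda>t. \<phi> (t, y1)", OF open_slices(1)[OF open_Omega, of y1] _ _ Dxx[OF O1]])
      (use Dx O1 max p1_eq in auto)
  moreover have "d22 (x1, y1) + \<epsilon> * b_yy (x1, y1) \<le> 0"
    by (rule local_max_second_deriv_nonpos[where f="\<lambda>t. \<phi> (x1, t)", OF open_slices(2)[OF open_Omega, of x1] _ _ Dyy[OF O1]])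
      (use Dy O1 max p1_eq in auto)
  moreover have "b_xx (x1, y1) + b_yy (x1, y1) = 0"
    unfolding b_xx_def b_yy_def prod.case sum.distrib[symmetric]
  proof (rule sum.neutral, clarify)
    fix a b assume "(a, b) \<in> corners"
    then have "sqdist (a, b) (x1, y1) > 0" using sq0[OF O1] by simp
    moreover have "4 * (x1 - a)\<^sup>2 / (sqdist (a, b) (x1, y1))\<^sup>2 + 4 * (y1 - b)\<^sup>2 / (sqdist (a, b) (x1, y1))\<^sup>2
        = 4 * sqdist (a, b) (x1, y1) / (sqdist (a, b) (x1, y1))\<^sup>2"
      unfolding add_divide_distrib[symmetric] by (simp add: sqdist_def)
    ultimately show "2 / sqdist (a, b) (x1, y1) - 4 * (x1 - fst (a, b))\<^sup>2 / (sqdist (a, b) (x1, y1))\<^sup>2 +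
       (2 / sqdist (a, b) (x1, y1) - 4 * (y1 - snd (a, b))\<^sup>2 / (sqdist (a, b) (x1, y1))\<^sup>2) = 0"
      by (simp add: power2_eq_square)
  qed
  moreover have "\<epsilon> * (b_xx (x1, y1) + b_yy (x1, y1)) = \<epsilon> * b_xx (x1, y1) + \<epsilon> * b_yy (x1, y1)"
    by (simp add: algebra_simps)
  ultimately show False
    using harm[OF O1] pos by (simp add: \<delta>_def)
qed

section \<open>Series of products with exponentially small factors\<close>

text \<open>
  Half of the wave number \<open>k \<pi>\<close> for \<open>k = 2 j + 1\<close>: the modes live on an interval of length two.
\<close>

definition freq :: "nat \<Rightarrow> real" where
  "freq j = real (2 * j + 1) * pi / 2"

lemma freq_gt_1: "freq j > 1"
proof -
  have "1 * (3 / 2) \<le> real (2 * j + 1) * (pi / 2)"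
    using pi_gt3 by (intro mult_mono) auto
  then show ?thesis by (simp add: freq_def)
qed

lemma freq_pos [simp]: "freq j > 0" "freq j \<ge> 0" "freq j \<noteq> 0"
  using freq_gt_1[of j] by linarith+

lemma power_le_exp:
  fixes x :: real
  assumes "x \<ge> 0"
  shows "x ^ p \<le> fact p * exp x"
proof -
  have "x ^ p /\<^sub>R fact p \<le> (\<Sum>n. x ^ n /\<^sub>R fact n)"
    using sum_le_suminf[OF summable_exp_generic, of "{p}" x] assms by simp
  then show ?thesis by (simp add: exp_def field_simps)
qed

lemma summable_exp_freq:
  assumes "c > 0"
  shows "summable (\<lambda>j. exp (- freq j * c))"
proof -
  have "exp (- freq j * c) = exp (- (pi * c / 2)) * exp (- (pi * c)) ^ j" for j
    by (simp add: freq_def exp_of_nat_mult[symmetric] exp_add[symmetric] algebra_simps add_divide_distrib)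
  moreover have "summable (\<lambda>j. exp (- (pi * c / 2)) * exp (- (pi * c)) ^ j)"
    using assms by (intro summable_mult summable_geometric) auto
  ultimately show ?thesis by simp
qed

text \<open>
  Half of the exponential absorbs the power, and the other half is a geometric series.
\<close>

lemma summable_power_exp_freq:
  assumes "c > 0"
  shows "summable (\<lambda>j. freq j ^ p * exp (- freq j * c))"
proof (rule summable_comparison_test')
  show "summable (\<lambda>j. (2 / c) ^ p * fact p * exp (- freq j * (c / 2)))"
    using assms by (intro summable_mult summable_exp_freq) auto
  fix j :: nat
  have "freq j ^ p = (2 / c) ^ p * (freq j * (c / 2)) ^ p"
    using assms by (simp add: power_mult_distrib[symmetric])
  also have "\<dots> \<le> (2 / c) ^ p * (fact p * exp (freq j * (c / 2)))"
    using assms by (intro mult_left_mono power_le_exp) auto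
  finally have "freq j ^ p * exp (- freq j * c)
      \<le> (2 / c) ^ p * (fact p * exp (freq j * (c / 2))) * exp (- freq j * c)"
    by (intro mult_right_mono) auto
  also have "\<dots> = (2 / c) ^ p * fact p * exp (- freq j * (c / 2))"
    by (simp add: exp_add[symmetric])
  finally show "norm (freq j ^ p * exp (- freq j * c)) \<le> (2 / c) ^ p * fact p * exp (- freq j * (c / 2))"
    by (simp add: abs_mult power_abs)
qed

text \<open>
  Polynomial growth in the frequency. Differentiating a mode costs a power of the frequency, so bounds of this
  kind pass from a family of modes to its derivatives.
\<close>

definition tempered :: "(nat \<Rightarrow> real \<Rightarrow> real) \<Rightarrow> bool" where
  "tempered f \<longleftrightarrow> (\<exists>K p. \<forall>j x. \<bar>x\<bar> \<le> 1 \<longrightarrow> \<bar>f j x\<bar> \<le> K * freq j ^ p)"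

text \<open>
  Up to powers of the frequency, the size of \<open>cosh (a y) / cosh a\<close>: exponentially small inside the interval, with a
  rate that degenerates linearly at its ends.
\<close>

definition decaying :: "(nat \<Rightarrow> real \<Rightarrow> real) \<Rightarrow> bool" where
  "decaying g \<longleftrightarrow> (\<exists>K p. \<forall>j y. \<bar>y\<bar> \<le> 1 \<longrightarrow> \<bar>g j y\<bar> \<le> K * freq j ^ p * exp (- freq j * (1 - \<bar>y\<bar>)))"

lemma temperedI:
  assumes "\<And>j x. \<bar>x\<bar> \<le> 1 \<Longrightarrow> \<bar>f j x\<bar> \<le> K * freq j ^ p"
  shows "tempered f"
  using assms by (auto simp: tempered_def)

lemma decayingI:
  assumes "\<And>j y. \<bar>y\<bar> \<le> 1 \<Longrightarrow> \<bar>g j y\<bar> \<le> K * freq j ^ p * exp (- freq j * (1 - \<bar>y\<bar>))"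
  shows "decaying g"
  using assms by (auto simp: decaying_def)

lemma decaying_mult:
  assumes "tempered f" "decaying g"
  shows "decaying (\<lambda>j y. f j y * g j y)"
proof -
  obtain K p L q where
    K: "\<And>j x. \<bar>x\<bar> \<le> 1 \<Longrightarrow> \<bar>f j x\<bar> \<le> K * freq j ^ p" and
    L: "\<And>j y. \<bar>y\<bar> \<le> 1 \<Longrightarrow> \<bar>g j y\<bar> \<le> L * freq j ^ q * exp (- freq j * (1 - \<bar>y\<bar>))"
    using assms unfolding tempered_def decaying_def by blast
  show ?thesis
  proof (rule decayingI)
    fix j and y :: real assume y: "\<bar>y\<bar> \<le> 1"
    have "\<bar>f j y * g j y\<bar> \<le> (K * freq j ^ p) * (L * freq j ^ q * exp (- freq j * (1 - \<bar>y\<bar>)))"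
      unfolding abs_mult
      by (rule mult_mono[OF K[OF y] L[OF y] order_trans[OF abs_ge_zero K[OF y]] abs_ge_zero])
    then show "\<bar>f j y * g j y\<bar> \<le> (K * L) * freq j ^ (p + q) * exp (- freq j * (1 - \<bar>y\<bar>))"
      by (simp add: power_add algebra_simps)
  qed
qed

lemma decaying_add:
  assumes "decaying f" "decaying g"
  shows "decaying (\<lambda>j y. f j y + g j y)"
proof -
  obtain K p L q where
    K: "\<And>j x. \<bar>x\<bar> \<le> 1 \<Longrightarrow> \<bar>f j x\<bar> \<le> K * freq j ^ p * exp (- freq j * (1 - \<bar>x\<bar>))" and
    L: "\<And>j y. \<bar>y\<bar> \<le> 1 \<Longrightarrow> \<bar>g j y\<bar> \<le> L * freq j ^ q * exp (- freq j * (1 - \<bar>y\<bar>))"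
    using assms unfolding decaying_def by blast
  show ?thesis
  proof (rule decayingI)
    fix j and y :: real assume y: "\<bar>y\<bar> \<le> 1"
    have *: "M * freq j ^ r * exp (- freq j * (1 - \<bar>y\<bar>)) \<le> \<bar>M\<bar> * freq j ^ (p + q) * exp (- freq j * (1 - \<bar>y\<bar>))"
      if "r \<le> p + q" for M r
      using freq_gt_1[of j] that by (intro mult_mono mult_right_mono power_increasing) auto
    show "\<bar>f j y + g j y\<bar> \<le> (\<bar>K\<bar> + \<bar>L\<bar>) * freq j ^ (p + q) * exp (- freq j * (1 - \<bar>y\<bar>))"
      using order_trans[OF K[OF y, of j] *[of p K]] order_trans[OF L[OF y, of j] *[of q L]]
      unfolding distrib_right by linarith
  qed
qed

definition product_series :: "(nat \<Rightarrow> real \<Rightarrow> real) \<Rightarrow> (nat \<Rightarrow> real \<Rightarrow> real) \<Rightarrow> real \<times> real \<Rightarrow> real" where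
  "product_series f g = (\<lambda>(x, y). \<Sum>j. f j x * g j y)"

text \<open>
  On a strip that stays away from the sides \<open>y = 1\<close> and \<open>y = -1\<close> the terms have one summable majorant. All statements
  on convergence, continuity and termwise differentiation of these series rest on it.
\<close>

lemma product_series_majorant:
  assumes "tempered f" "decaying g" and r: "r < 1"
  obtains M where "summable M" "\<And>j x y. \<bar>x\<bar> \<le> 1 \<Longrightarrow> \<bar>y\<bar> \<le> r \<Longrightarrow> \<bar>f j x * g j y\<bar> \<le> M j"
proof -
  obtain K p L q where
    K: "\<And>j x. \<bar>x\<bar> \<le> 1 \<Longrightarrow> \<bar>f j x\<bar> \<le> K * freq j ^ p" and
    L: "\<And>j y. \<bar>y\<bar> \<le> 1 \<Longrightarrow> \<bar>g j y\<bar> \<le> L * freq j ^ q * exp (- freq j * (1 - \<bar>y\<bar>))"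
    using assms(1,2) unfolding tempered_def decaying_def by blast
  define M where "M j = \<bar>K\<bar> * \<bar>L\<bar> * (freq j ^ (p + q) * exp (- freq j * (1 - r)))" for j
  have "summable M"
    unfolding M_def using r by (intro summable_mult summable_power_exp_freq) auto
  moreover have "\<bar>f j x * g j y\<bar> \<le> M j" if "\<bar>x\<bar> \<le> 1" "\<bar>y\<bar> \<le> r" for j x y
  proof -
    have "\<bar>g j y\<bar> \<le> L * freq j ^ q * exp (- freq j * (1 - \<bar>y\<bar>))"
      using that r by (intro L) auto
    also have "\<dots> \<le> \<bar>L\<bar> * freq j ^ q * exp (- freq j * (1 - \<bar>y\<bar>))"
      by (intro mult_right_mono) auto
    also have "\<dots> \<le> \<bar>L\<bar> * freq j ^ q * exp (- freq j * (1 - r))"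
      using that by (intro mult_left_mono) auto
    finally have g: "\<bar>g j y\<bar> \<le> \<bar>L\<bar> * freq j ^ q * exp (- freq j * (1 - r))" .
    have f: "\<bar>f j x\<bar> \<le> \<bar>K\<bar> * freq j ^ p"
      by (rule order_trans[OF K[OF that(1)]]) (intro mult_right_mono, auto)
    have "\<bar>f j x * g j y\<bar> \<le> (\<bar>K\<bar> * freq j ^ p) * (\<bar>L\<bar> * freq j ^ q * exp (- freq j * (1 - r)))"
      unfolding abs_mult by (rule mult_mono[OF f g order_trans[OF abs_ge_zero f] abs_ge_zero])
    then show ?thesis by (simp add: M_def power_add algebra_simps)
  qed
  ultimately show ?thesis by (rule that)
qed

lemma summable_product_series:
  assumes "tempered f" "decaying g" "\<bar>x\<bar> \<le> 1" "\<bar>y\<bar> < 1"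
  shows "summable (\<lambda>j. f j x * g j y)"
proof -
  obtain M where M: "summable M" "\<And>j x' y'. \<bar>x'\<bar> \<le> 1 \<Longrightarrow> \<bar>y'\<bar> \<le> \<bar>y\<bar> \<Longrightarrow> \<bar>f j x' * g j y'\<bar> \<le> M j"
    using product_series_majorant[OF assms(1,2,4)] by metis
  show ?thesis
    by (rule summable_comparison_test'[OF M(1)]) (use M(2)[OF assms(3) order_refl] in simp)
qed

text \<open>
  The sides \<open>x = 1\<close> and \<open>x = -1\<close> are included: only the approach to the other two sides destroys uniform
  convergence.
\<close>

lemma continuous_on_product_series:
  assumes fg: "tempered f" "decaying g"
    and f: "\<And>j. continuous_on UNIV (f j)" and g: "\<And>j. continuous_on UNIV (g j)"
  shows "continuous_on ({-1..1} \<times> {-1<..<1}) (product_series f g)"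
proof -
  have *: "continuous_on ({-1..1} \<times> {-r<..<r}) (product_series f g)" if r: "r < 1" for r
  proof -
    obtain M where M: "summable M" "\<And>j x y. \<bar>x\<bar> \<le> 1 \<Longrightarrow> \<bar>y\<bar> \<le> r \<Longrightarrow> \<bar>f j x * g j y\<bar> \<le> M j"
      using product_series_majorant[OF fg r] by metis
    have "uniform_limit ({-1..1} \<times> {-r<..<r}) (\<lambda>n p. \<Sum>j<n. f j (fst p) * g j (snd p))
            (\<lambda>p. \<Sum>j. f j (fst p) * g j (snd p)) sequentially"
      by (rule Weierstrass_m_test[OF _ M(1)]) (auto intro!: M(2))
    then have "continuous_on ({-1..1} \<times> {-r<..<r}) (\<lambda>p. \<Sum>j. f j (fst p) * g j (snd p))"
    proof (rule uniform_limit_theorem[rotated])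
      show "\<forall>\<^sub>F n in sequentially. continuous_on ({-1..1} \<times> {-r<..<r}) (\<lambda>p. \<Sum>j<n. f j (fst p) * g j (snd p))"
        by (intro always_eventually allI continuous_on_sum continuous_on_mult
            continuous_on_compose2[OF f] continuous_on_compose2[OF g] continuous_intros) auto
    qed auto
    then show ?thesis by (simp add: product_series_def case_prod_unfold)
  qed
  show ?thesis
  proof (rule continuous_on_eq_continuous_within[THEN iffD2], rule ballI)
    fix p :: "real \<times> real" assume p: "p \<in> {-1..1} \<times> {-1<..<1}"
    define r where "r = (1 + \<bar>snd p\<bar>) / 2"
    have r: "r < 1" "\<bar>snd p\<bar> < r" using p by (auto simp: r_def)
    have eq: "({-1..1} \<times> {-1<..<1}) \<inter> (UNIV \<times> {-r<..<r}) = {-1..1} \<times> {-r<..<r}"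
      using r by auto
    have "continuous (at p within {-1..1} \<times> {-r<..<r}) (product_series f g)"
      using *[OF r(1)] p r unfolding continuous_on_eq_continuous_within
      by (cases p) (auto simp: abs_less_iff)
    moreover have "at p within ({-1..1} \<times> {-1<..<1}) = at p within ({-1..1} \<times> {-r<..<r})"
    proof (rule at_within_nhd[where S="UNIV \<times> {-r<..<r}"])
      show "p \<in> UNIV \<times> {-r<..<r}" using r by (auto simp: mem_Times_iff abs_less_iff)
      show "open ((UNIV :: real set) \<times> {-r<..<r})" by (intro open_Times) auto
      show "{-1..1} \<times> {-1<..<1} \<inter> UNIV \<times> {-r<..<r} - {p} = {-1..1} \<times> {-r<..<r} \<inter> UNIV \<times> {-r<..<r} - {p}"
        unfolding eq by auto
    qed
    ultimately show "continuous (at p within {-1..1} \<times> {-1<..<1}) (product_series f g)"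
      by simp
  qed
qed

lemma has_partials_on_product_series:
  assumes f: "tempered f" "tempered f'" "\<And>j x. (f j has_real_derivative f' j x) (at x)"
    and g: "decaying g" "decaying g'" "\<And>j y. (g j has_real_derivative g' j y) (at y)"
  shows "has_partials_on Omega (product_series f g) (product_series f' g) (product_series f g')"
  unfolding has_partials_on_def
proof (clarify, intro conjI)
  fix x y assume "(x, y) \<in> Omega"
  then have xy: "\<bar>x\<bar> < 1" "\<bar>y\<bar> < 1" by (auto simp: Omega_def)
  have uc: "uniformly_convergent_on T (\<lambda>n t. \<Sum>i<n. u i (h t) * v i (k t))"
    if u: "tempered u" and v: "decaying v" and r: "r < 1"
      and hk: "\<And>t. t \<in> T \<Longrightarrow> \<bar>h t\<bar> \<le> 1" "\<And>t. t \<in> T \<Longrightarrow> \<bar>k t\<bar> \<le> r"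
    for u v h k r and T :: "real set"
  proof -
    obtain M where M: "summable M" "\<And>j x y. \<bar>x\<bar> \<le> 1 \<Longrightarrow> \<bar>y\<bar> \<le> r \<Longrightarrow> \<bar>u j x * v j y\<bar> \<le> M j"
      using product_series_majorant[OF u v r] by metis
    show ?thesis
      by (rule Weierstrass_m_test'[OF _ M(1)]) (simp add: M(2) hk)
  qed
  show "((\<lambda>t. product_series f g (t, y)) has_real_derivative product_series f' g (x, y)) (at x)"
    unfolding product_series_def prod.case
  proof (rule has_field_derivative_series'(2)[where S="{-1..1}" and x0=x])
    show "((\<lambda>t. f n t * g n y) has_real_derivative f' n t * g n y) (at t within {-1..1})" for n t
      using f(3) by (intro DERIV_cmult_right DERIV_subset[OF f(3)]) auto
    show "uniformly_convergent_on {-1..1} (\<lambda>n t. \<Sum>i<n. f' i t * g i y)"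
      by (rule uc[OF f(2) g(1) xy(2)]) auto
    show "summable (\<lambda>n. f n x * g n y)"
      using xy by (intro summable_product_series f g) auto
  qed (use xy in \<open>auto simp: interior_atLeastAtMost_real\<close>)
  \<comment> \<open>a strip that contains \<open>y\<close> in its interior and still stays away from the sides\<close>
  define r where "r = (1 + \<bar>y\<bar>) / 2"
  have r: "r < 1" "\<bar>y\<bar> < r" using xy by (auto simp: r_def)
  show "((\<lambda>t. product_series f g (x, t)) has_real_derivative product_series f g' (x, y)) (at y)"
    unfolding product_series_def prod.case
  proof (rule has_field_derivative_series'(2)[where S="{-r..r}" and x0=y])
    show "((\<lambda>t. f n x * g n t) has_real_derivative f n x * g' n t) (at t within {-r..r})" for n t
      by (intro DERIV_cmult DERIV_subset[OF g(3)]) auto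
    show "uniformly_convergent_on {-r..r} (\<lambda>n t. \<Sum>i<n. f i x * g' i t)"
      by (rule uc[OF f(1) g(2) r(1)]) (use xy in auto)
    show "summable (\<lambda>n. f n x * g n y)"
      using xy by (intro summable_product_series f g) auto
  qed (use r in \<open>auto simp: interior_atLeastAtMost_real\<close>)
qed

section \<open>Sine modes and the profiles that solve the mode equation\<close>

definition cosh_ratio :: "nat \<Rightarrow> real \<Rightarrow> real" where
  "cosh_ratio j y = cosh (freq j * y) / cosh (freq j)"

definition sinh_ratio :: "nat \<Rightarrow> real \<Rightarrow> real" where
  "sinh_ratio j y = sinh (freq j * y) / cosh (freq j)"

definition sine_mode :: "nat \<Rightarrow> real \<Rightarrow> real" where
  "sine_mode j x = sin (freq j * (x + 1))"

definition sine_mode' :: "nat \<Rightarrow> real \<Rightarrow> real" where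
  "sine_mode' j x = freq j * cos (freq j * (x + 1))"

definition sine_mode'' :: "nat \<Rightarrow> real \<Rightarrow> real" where
  "sine_mode'' j x = - ((freq j)\<^sup>2) * sine_mode j x"

text \<open>
  The solution of \<open>w'' - a\<^sup>2 w = - 2 a cosh (a y) / cosh a\<close> that vanishes at both ends of \<open>[-1, 1]\<close>.
\<close>

definition profile :: "nat \<Rightarrow> real \<Rightarrow> real" where
  "profile j y = tanh (freq j) * cosh_ratio j y + (- y) * sinh_ratio j y"

definition profile' :: "nat \<Rightarrow> real \<Rightarrow> real" where
  "profile' j y = (freq j * tanh (freq j) - 1) * sinh_ratio j y + (- (freq j * y)) * cosh_ratio j y"

definition profile'' :: "nat \<Rightarrow> real \<Rightarrow> real" where
  "profile'' j y = ((freq j)\<^sup>2 * tanh (freq j) - 2 * freq j) * cosh_ratio j y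
                   + (- ((freq j)\<^sup>2 * y)) * sinh_ratio j y"

lemma inverse_cosh_freq_le: "1 / cosh (freq j) \<le> 2 * exp (- freq j)"
proof -
  have "exp (freq j) \<le> 2 * cosh (freq j)" by (simp add: cosh_def)
  then show ?thesis by (simp add: exp_minus field_simps)
qed

lemma abs_sinh_le_cosh: "\<bar>sinh x\<bar> \<le> cosh (x :: real)"
  by (simp add: sinh_def cosh_def abs_le_iff)

lemma cosh_ratio_le:
  "cosh_ratio j y \<le> 2 * freq j ^ 0 * exp (- freq j * (1 - \<bar>y\<bar>))"
proof -
  have "cosh (freq j * y) = cosh (freq j * \<bar>y\<bar>)" by (simp add: abs_if)
  also have "\<dots> \<le> exp (freq j * \<bar>y\<bar>)" by (simp add: cosh_def)
  finally have "cosh (freq j * y) * (1 / cosh (freq j)) \<le> exp (freq j * \<bar>y\<bar>) * (2 * exp (- freq j))"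
    by (intro mult_mono inverse_cosh_freq_le) auto
  then show ?thesis by (simp add: cosh_ratio_def exp_add[symmetric] algebra_simps)
qed

lemma decaying_ratios: "decaying cosh_ratio" "decaying sinh_ratio"
proof -
  show "decaying cosh_ratio"
    by (rule decayingI[of _ 2 0]) (use cosh_ratio_le in \<open>simp add: cosh_ratio_def\<close>)
  have "\<bar>sinh_ratio j y\<bar> \<le> cosh_ratio j y" for j y
    using abs_sinh_le_cosh[of "freq j * y"] by (simp add: sinh_ratio_def cosh_ratio_def divide_right_mono)
  then show "decaying sinh_ratio"
    by (intro decayingI[of _ 2 0] order_trans[OF _ cosh_ratio_le])
qed

lemma abs_tanh_le_1: "\<bar>tanh x\<bar> \<le> (1 :: real)"
  using abs_sinh_le_cosh[of x] by (simp add: tanh_def)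

lemma tempered_coefficients:
  "tempered (\<lambda>j y. tanh (freq j))" "tempered (\<lambda>j y. - y)"
  "tempered (\<lambda>j y. freq j * tanh (freq j) - 1)" "tempered (\<lambda>j y. - (freq j * y))"
  "tempered (\<lambda>j y. (freq j)\<^sup>2 * tanh (freq j) - 2 * freq j)" "tempered (\<lambda>j y. - ((freq j)\<^sup>2 * y))"
  "tempered (\<lambda>j y. 2 / freq j)" "tempered (\<lambda>j y. 2)" "tempered (\<lambda>j y. 2 * freq j)"
proof -
  have ft: "\<bar>freq j ^ p * tanh (freq j)\<bar> \<le> freq j ^ p" for p j
    using abs_tanh_le_1[of "freq j"] by (simp add: abs_mult mult_left_le)
  have fy: "\<bar>freq j ^ p * y\<bar> \<le> freq j ^ p" if "\<bar>y\<bar> \<le> 1" for p j y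
    using that by (simp add: abs_mult mult_left_le)
  have f1: "1 \<le> freq j" for j using freq_gt_1[of j] by simp
  have f2: "freq j \<le> (freq j)\<^sup>2" for j using f1[of j] by (simp add: power2_eq_square)
  show "tempered (\<lambda>j y. tanh (freq j))" by (rule temperedI[of _ 1 0]) (metis abs_tanh_le_1 mult_1 power_0)
  show "tempered (\<lambda>j y. - y)" by (rule temperedI[of _ 1 0]) auto
  show "tempered (\<lambda>j y. freq j * tanh (freq j) - 1)"
    by (rule temperedI[of _ 2 1]) (use ft[of _ 1] f1 in \<open>smt (verit) power_one_right\<close>)
  show "tempered (\<lambda>j y. - (freq j * y))" by (rule temperedI[of _ 1 1]) (use fy[of _ _ 1] in auto)
  show "tempered (\<lambda>j y. (freq j)\<^sup>2 * tanh (freq j) - 2 * freq j)"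
    by (rule temperedI[of _ 3 2]) (use ft[of _ 2] f1 f2 in \<open>smt (verit)\<close>)
  show "tempered (\<lambda>j y. - ((freq j)\<^sup>2 * y))" by (rule temperedI[of _ 1 2]) (use fy[of _ _ 2] in auto)
  show "tempered (\<lambda>j y. 2 / freq j)" by (rule temperedI[of _ 2 0]) (use f1 in \<open>auto simp: field_simps\<close>)
  show "tempered (\<lambda>j y. 2)" by (rule temperedI[of _ 2 0]) auto
  show "tempered (\<lambda>j y. 2 * freq j)" by (rule temperedI[of _ 2 1]) auto
qed

lemma decaying_profile: "decaying profile" "decaying profile'" "decaying profile''"
  unfolding profile_def profile'_def profile''_def
  by (intro decaying_add decaying_mult tempered_coefficients decaying_ratios)+

lemma tempered_sine_mode:
  "tempered sine_mode" "tempered sine_mode'"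
  "tempered sine_mode''"
proof -
  show "tempered sine_mode" by (rule temperedI[of _ 1 0]) (simp add: sine_mode_def)
  show "tempered sine_mode'"
    by (rule temperedI[of _ 1 1]) (simp add: sine_mode'_def abs_mult mult_left_le)
  show "tempered sine_mode''"
    by (rule temperedI[of _ 1 2]) (simp add: sine_mode''_def sine_mode_def abs_mult mult_left_le)
qed

lemma DERIV_ratios:
  "(cosh_ratio j has_real_derivative freq j * sinh_ratio j y) (at y)"
  "(sinh_ratio j has_real_derivative freq j * cosh_ratio j y) (at y)"
  unfolding cosh_ratio_def sinh_ratio_def by (auto intro!: derivative_eq_intros)

lemma DERIV_sine_mode:
  "(sine_mode j has_real_derivative sine_mode' j x) (at x)"
  "(sine_mode' j has_real_derivative sine_mode'' j x) (at x)"
  unfolding sine_mode_def sine_mode'_def sine_mode''_def by (auto intro!: derivative_eq_intros simp: power2_eq_square)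

lemma DERIV_profile:
  "(profile j has_real_derivative profile' j y) (at y)"
  "(profile' j has_real_derivative profile'' j y) (at y)"
  unfolding profile_def profile'_def profile''_def
  by (auto intro!: derivative_eq_intros DERIV_ratios simp: algebra_simps power2_eq_square)

lemma DERIV_imp_continuous_on_UNIV:
  fixes f :: "real \<Rightarrow> real"
  assumes "\<And>x. (f has_real_derivative f' x) (at x)"
  shows "continuous_on UNIV f"
  using assms by (intro DERIV_continuous_on[of UNIV f f']) auto

lemma continuous_on_ratios: "continuous_on UNIV (cosh_ratio j)" "continuous_on UNIV (sinh_ratio j)"
  by (rule DERIV_imp_continuous_on_UNIV[OF DERIV_ratios(1)] DERIV_imp_continuous_on_UNIV[OF DERIV_ratios(2)])+

lemma continuous_on_sine_mode: "continuous_on UNIV (sine_mode j)"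
  by (rule DERIV_imp_continuous_on_UNIV[OF DERIV_sine_mode(1)])

lemma continuous_on_profile: "continuous_on UNIV (profile j)"
  by (rule DERIV_imp_continuous_on_UNIV[OF DERIV_profile(1)])

lemma swap_Omega: "prod.swap ` Omega = Omega"
  unfolding Omega_def by (rule product_swap)

lemma swap_in_Omega: "(y, x) \<in> Omega \<longleftrightarrow> (x, y) \<in> Omega"
  by (auto simp: Omega_def)

section \<open>The equation inside the square\<close>

text \<open>
  Both \<open>q0\<close> and the solution have the form \<open>c (P(x, y) + b P(y, x))\<close> for a product series \<open>P\<close>, with \<open>b = -1\<close> and
  \<open>b = 1\<close> respectively, so their regularity and second derivatives are obtained together. It is enough that \<open>h\<close>
  agrees with this expression inside the square.
\<close>

lemma symmetrized_product_series:
  assumes f: "tempered f" "tempered f'" "tempered f''"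
      "\<And>j x. (f j has_real_derivative f' j x) (at x)" "\<And>j x. (f' j has_real_derivative f'' j x) (at x)"
      "\<And>j. continuous_on UNIV (f'' j)"
    and g: "decaying g" "decaying g'" "decaying g''"
      "\<And>j x. (g j has_real_derivative g' j x) (at x)" "\<And>j x. (g' j has_real_derivative g'' j x) (at x)"
      "\<And>j. continuous_on UNIV (g'' j)"
    and h: "\<And>x y. (x, y) \<in> Omega \<Longrightarrow>
          h (x, y) = c * (product_series f g (x, y) + b * product_series f g (y, x))"
  shows "C2_on Omega h"
    and "(x, y) \<in> Omega \<Longrightarrow>
          dx (dx h) (x, y) = c * (product_series f'' g (x, y) + b * product_series f g'' (y, x))"
    and "(x, y) \<in> Omega \<Longrightarrow>
          dy (dy h) (x, y) = c * (product_series f g'' (x, y) + b * product_series f'' g (y, x))"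
proof -
  define comb where "comb u v p = c * (product_series (fst u) (snd u) p
      + b * (\<lambda>(x, y). product_series (fst v) (snd v) (y, x)) p)" for u v p
  have part: "has_partials_on Omega (comb (f0, g0) (f0', g0')) (comb (f1, g0) (f0', g1')) (comb (f0, g1) (f1', g0'))"
    if "has_partials_on Omega (product_series f0 g0) (product_series f1 g0) (product_series f0 g1)"
      "has_partials_on Omega (product_series f0' g0') (product_series f1' g0') (product_series f0' g1')"
    for f0 g0 f0' g0' f1 g1 f1' g1'
    using has_partials_on_lincomb[OF that(1) has_partials_on_swap[OF that(2), unfolded swap_Omega], of c b]
    by (simp add: comb_def[abs_def])
  have P: "has_partials_on Omega (product_series f g) (product_series f' g) (product_series f g')"
    "has_partials_on Omega (product_series f' g) (product_series f'' g) (product_series f' g')"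
    "has_partials_on Omega (product_series f g') (product_series f' g') (product_series f g'')"
    by (intro has_partials_on_product_series f g)+
  note h0 = part[OF P(1) P(1)]
  note h1 = part[OF P(2) P(3)]
  note h2 = part[OF P(3) P(2)]
  have "has_partials_on Omega h (comb (f', g) (f, g')) (comb (f, g') (f', g))"
    by (rule has_partials_on_cong[OF open_Omega h0]) (auto simp: h comb_def)
  note hp = this second_partials[OF open_Omega this h1 h2]
  have cf: "continuous_on UNIV (f j)" "continuous_on UNIV (f' j)" "continuous_on UNIV (g j)" "continuous_on UNIV (g' j)" for j
    using f(4,5) g(4,5) by (blast intro: DERIV_imp_continuous_on_UNIV)+
  have cont: "continuous_on Omega (comb (f0, g0) (f1, g1))"
    if "tempered f0" "tempered f1" "decaying g0" "decaying g1"
      "\<And>j. continuous_on UNIV (f0 j)" "\<And>j. continuous_on UNIV (f1 j)"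
      "\<And>j. continuous_on UNIV (g0 j)" "\<And>j. continuous_on UNIV (g1 j)" for f0 f1 g0 g1
  proof -
    have "continuous_on Omega (product_series f0 g0)" "continuous_on Omega (product_series f1 g1)"
      using that by (auto intro!: continuous_on_subset[OF continuous_on_product_series] simp: Omega_def)
    moreover from this(2) have "continuous_on Omega (product_series f1 g1 \<circ> prod.swap)"
      by (intro continuous_on_compose continuous_on_swap) (simp add: swap_Omega)
    moreover have "product_series f1 g1 \<circ> prod.swap = (\<lambda>(x, y). product_series f1 g1 (y, x))"
      by auto
    ultimately show ?thesis
      unfolding comb_def by (auto intro!: continuous_intros)
  qed
  show "C2_on Omega h"
    unfolding C2_on_def
    by (intro conjI C1_onI[OF hp(1)] C1_onI[OF hp(2)] C1_onI[OF hp(3)] cont f g cf)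
  show "(x, y) \<in> Omega \<Longrightarrow>
      dx (dx h) (x, y) = c * (product_series f'' g (x, y) + b * product_series f g'' (y, x))"
    "(x, y) \<in> Omega \<Longrightarrow>
      dy (dy h) (x, y) = c * (product_series f g'' (x, y) + b * product_series f'' g (y, x))"
    using hp(4,5)[of "(x, y)"] by (simp_all add: comb_def)
qed

text \<open>
  The coefficients \<open>2 / a\<^sub>j\<close> are those of the constant function one in its sine series on \<open>[-1, 1]\<close>, so these
  profiles build the harmonic function that is one on \<open>y = 1\<close> and \<open>y = -1\<close> and zero on the other two sides.
\<close>

definition boundary_profile :: "nat \<Rightarrow> real \<Rightarrow> real" where
  "boundary_profile j y = 2 / freq j * cosh_ratio j y"

text \<open>
  The second derivative of the boundary profile, and also minus the left-hand side \<open>w'' - a\<^sup>2 w\<close> for the profile \<open>w\<close>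
  of the solution. This coincidence is what solves the equation.
\<close>

definition forcing_profile :: "nat \<Rightarrow> real \<Rightarrow> real" where
  "forcing_profile j y = 2 * freq j * cosh_ratio j y"

lemma decaying_boundary_profile:
  "decaying boundary_profile" "decaying (\<lambda>j y. 2 * sinh_ratio j y)" "decaying forcing_profile"
  unfolding boundary_profile_def forcing_profile_def
  by (intro decaying_mult tempered_coefficients decaying_ratios)+

text \<open>
  Adding the two hyperbolic sines gives \<open>2 sinh a cosh (a y)\<close>, and the denominator is \<open>sinh (2 a) = 2 sinh a cosh a\<close>.
\<close>

lemma q0_eq_product_series:
  assumes "(x, y) \<in> Omega"
  shows "q0 s (x, y) = s / 2 * (product_series sine_mode boundary_profile (x, y)
                                + (- 1) * product_series sine_mode boundary_profile (y, x))"
proof -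
  have ratio: "(sinh (real (2 * j + 1) * pi * (1 - t) / 2) + sinh (real (2 * j + 1) * pi * (1 + t) / 2))
      / sinh (real (2 * j + 1) * pi) = cosh_ratio j t" for j t
  proof -
    have args: "real (2 * j + 1) * pi * (1 - t) / 2 = freq j - freq j * t"
      "real (2 * j + 1) * pi * (1 + t) / 2 = freq j + freq j * t"
      "real (2 * j + 1) * pi = 2 * freq j"
      by (auto simp: freq_def field_simps)
    show ?thesis
      unfolding args(1,2) unfolding args(3) sinh_double sinh_diff sinh_add cosh_ratio_def by simp
  qed
  have "summable (\<lambda>j. sine_mode j x * boundary_profile j y)" "summable (\<lambda>j. sine_mode j y * boundary_profile j x)"
    using assms by (auto intro!: summable_product_series tempered_sine_mode decaying_boundary_profile simp: Omega_def)
  note diff = suminf_diff[OF this]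
  have term_eq: "4 / (real (2 * j + 1) * pi) *
        (sin (real (2 * j + 1) * pi * (x + 1) / 2) * cosh_ratio j y
         - sin (real (2 * j + 1) * pi * (y + 1) / 2) * cosh_ratio j x)
      = sine_mode j x * boundary_profile j y - sine_mode j y * boundary_profile j x" for j
  proof -
    have "4 / (real (2 * j + 1) * pi) = 2 / freq j"
      "real (2 * j + 1) * pi * (x + 1) / 2 = freq j * (x + 1)"
      "real (2 * j + 1) * pi * (y + 1) / 2 = freq j * (y + 1)"
      by (simp_all add: freq_def)
    then show ?thesis by (simp only: sine_mode_def boundary_profile_def) (simp add: algebra_simps)
  qed
  show ?thesis
    unfolding q0_def prod.case Let_def ratio term_eq diff[symmetric] product_series_def by simp
qed

text \<open>
  Each mode is harmonic, so its two second derivatives are opposite. In the difference the antisymmetry of \<open>q0\<close>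
  therefore turns into a symmetric expression.
\<close>

lemma q0_second_partials:
  assumes "(x, y) \<in> Omega"
  shows "dy (dy (q0 s)) (x, y) - dx (dx (q0 s)) (x, y)
    = s * (product_series sine_mode forcing_profile (x, y) + product_series sine_mode forcing_profile (y, x))"
proof -
  have D: "(boundary_profile j has_real_derivative 2 * sinh_ratio j t) (at t)"
    "((\<lambda>t. 2 * sinh_ratio j t) has_real_derivative forcing_profile j t) (at t)" for j t
    unfolding boundary_profile_def forcing_profile_def
    by (auto intro!: derivative_eq_intros DERIV_ratios)
  note d = symmetrized_product_series(2,3)[where h="q0 s", OF tempered_sine_mode DERIV_sine_mode _
      decaying_boundary_profile D _ q0_eq_product_series assms]
  have "continuous_on UNIV (forcing_profile j)" "continuous_on UNIV (sine_mode'' j)" for j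
    unfolding forcing_profile_def sine_mode''_def
    by (intro continuous_intros continuous_on_ratios continuous_on_sine_mode)+
  note d = d[OF this(2,1)]
  have neg: "product_series sine_mode'' boundary_profile q = - product_series sine_mode forcing_profile q"
    if "q \<in> Omega" for q
  proof -
    obtain t u where q: "q = (t, u)" "\<bar>t\<bar> < 1" "\<bar>u\<bar> < 1" using \<open>q \<in> Omega\<close> by (cases q) (auto simp: Omega_def)
    have "sine_mode'' j t * boundary_profile j u = - (sine_mode j t * forcing_profile j u)" for j
      by (simp add: sine_mode''_def boundary_profile_def forcing_profile_def power2_eq_square)
    moreover have "summable (\<lambda>j. sine_mode j t * forcing_profile j u)"
      using q by (intro summable_product_series tempered_sine_mode decaying_boundary_profile) auto
    ultimately show ?thesis
      by (simp add: product_series_def q suminf_minus)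
  qed
  have "dx (dx (q0 s)) (x, y) = s / 2 * (product_series sine_mode'' boundary_profile (x, y) + (- 1) * product_series sine_mode forcing_profile (y, x))"
    by (rule d(1))
  moreover have "dy (dy (q0 s)) (x, y) = s / 2 * (product_series sine_mode forcing_profile (x, y) + (- 1) * product_series sine_mode'' boundary_profile (y, x))"
    by (rule d(2))
  ultimately show ?thesis
    using neg[OF assms] neg[OF iffD2[OF swap_in_Omega assms]] by (simp add: algebra_simps)
qed

text \<open>
  The part of the solution, up to the factor \<open>s / 6\<close>, that is driven by the sides \<open>y = 1\<close> and \<open>y = -1\<close>; its
  reflection in the diagonal is the other part.
\<close>

definition half_solution :: "real \<times> real \<Rightarrow> real" where
  "half_solution = product_series sine_mode profile"

definition solution :: "real \<Rightarrow> real \<times> real \<Rightarrow> real" where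
  "solution s = (\<lambda>(x, y). s / 6 * (half_solution (x, y) + 1 * half_solution (y, x)))"

lemma solution_C2_and_laplacian:
  shows "C2_on Omega (solution s)"
    and "p \<in> Omega \<Longrightarrow> laplacian (solution s) p = - (1 / 6) * (dy (dy (q0 s)) p - dx (dx (q0 s)) p)"
proof -
  have "continuous_on UNIV (profile'' j)" "continuous_on UNIV (sine_mode'' j)" for j
    unfolding profile''_def sine_mode''_def
    by (intro continuous_intros continuous_on_ratios continuous_on_sine_mode)+
  note d = symmetrized_product_series[OF tempered_sine_mode DERIV_sine_mode this(2)
      decaying_profile DERIV_profile this(1), of "solution s" "s / 6" 1,
      unfolded solution_def half_solution_def prod.case, OF refl]
  show "C2_on Omega (solution s)"
    using d(1) by (simp add: solution_def half_solution_def)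
  assume "p \<in> Omega"
  then obtain x y where p: "p = (x, y)" and O: "(x, y) \<in> Omega" by (cases p) auto
  have sum: "product_series sine_mode'' profile q + product_series sine_mode profile'' q
      = - product_series sine_mode forcing_profile q" if "q \<in> Omega" for q
  proof -
    obtain t u where q: "q = (t, u)" "\<bar>t\<bar> < 1" "\<bar>u\<bar> < 1" using \<open>q \<in> Omega\<close> by (cases q) (auto simp: Omega_def)
    have "sine_mode'' j t * profile j u + sine_mode j t * profile'' j u = - (sine_mode j t * forcing_profile j u)" for j
      by (simp add: sine_mode''_def profile_def profile''_def forcing_profile_def algebra_simps)
    moreover have "summable (\<lambda>j. sine_mode'' j t * profile j u)"
      "summable (\<lambda>j. sine_mode j t * profile'' j u)" "summable (\<lambda>j. sine_mode j t * forcing_profile j u)"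
      using q by (intro summable_product_series tempered_sine_mode decaying_profile decaying_boundary_profile; simp)+
    ultimately show ?thesis
      by (simp add: product_series_def q suminf_add suminf_minus)
  qed
  have "product_series sine_mode forcing_profile q
      = - product_series sine_mode'' profile q - product_series sine_mode profile'' q" if "q \<in> Omega" for q
    using sum[OF that] by linarith
  note forcing = this[OF O] this[OF iffD2[OF swap_in_Omega O]]
  have "dx (dx (solution s)) (x, y) = s / 6 * (product_series sine_mode'' profile (x, y) + 1 * product_series sine_mode profile'' (y, x))"
    "dy (dy (solution s)) (x, y) = s / 6 * (product_series sine_mode profile'' (x, y) + 1 * product_series sine_mode'' profile (y, x))"
    using d(2,3)[OF O] by (simp_all only: solution_def half_solution_def)
  then show "laplacian (solution s) p = - (1 / 6) * (dy (dy (q0 s)) p - dx (dx (q0 s)) p)"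
    unfolding p q0_second_partials[OF O] laplacian_def forcing by (simp add: algebra_simps)
qed

section \<open>Behaviour at the boundary, existence and uniqueness\<close>

lemma summation_by_parts:
  fixes b t :: "nat \<Rightarrow> real"
  shows "(\<Sum>j<n. b j * t j) = b n * (\<Sum>j<n. t j) + (\<Sum>j<n. (b j - b (Suc j)) * (\<Sum>i<Suc j. t i))"
  by (induction n) (auto simp: algebra_simps)

text \<open>
  Dirichlet's test with an explicit constant: after summation by parts only the partial sums of \<open>t\<close> and the total
  variation of \<open>b\<close> matter. It is used for the oscillating sines near the sides of the square and for the row tails
  of the double series.
\<close>

lemma abel_bound:
  fixes b t :: "nat \<Rightarrow> real"
  assumes B: "\<And>n. \<bar>\<Sum>j<n. t j\<bar> \<le> B"
    and b: "b \<longlonglongrightarrow> 0" and var: "(\<lambda>j. \<bar>b j - b (Suc j)\<bar>) sums V"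
    and bt: "summable (\<lambda>j. b j * t j)"
  shows "\<bar>\<Sum>j. b j * t j\<bar> \<le> B * V"
proof (rule LIMSEQ_le)
  show "(\<lambda>n. \<bar>\<Sum>j<n. b j * t j\<bar>) \<longlonglongrightarrow> \<bar>\<Sum>j. b j * t j\<bar>"
    by (intro tendsto_rabs summable_LIMSEQ bt)
  have "(\<lambda>n. \<bar>b n\<bar> * B + (\<Sum>j<n. \<bar>b j - b (Suc j)\<bar>) * B) \<longlonglongrightarrow> \<bar>0\<bar> * B + V * B"
    using var unfolding sums_def by (intro tendsto_intros b)
  then show "(\<lambda>n. \<bar>b n\<bar> * B + (\<Sum>j<n. \<bar>b j - b (Suc j)\<bar>) * B) \<longlonglongrightarrow> B * V"
    by (simp add: mult.commute)
  have "\<bar>\<Sum>j<n. b j * t j\<bar> \<le> \<bar>b n\<bar> * B + (\<Sum>j<n. \<bar>b j - b (Suc j)\<bar>) * B" for n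
  proof -
    have "\<bar>\<Sum>j<n. (b j - b (Suc j)) * (\<Sum>i<Suc j. t i)\<bar> \<le> (\<Sum>j<n. \<bar>b j - b (Suc j)\<bar> * B)"
      by (rule order_trans[OF sum_abs]) (auto intro!: sum_mono mult_left_mono B simp: abs_mult simp del: sum.lessThan_Suc)
    moreover have "\<bar>b n * (\<Sum>j<n. t j)\<bar> \<le> \<bar>b n\<bar> * B"
      unfolding abs_mult by (intro mult_left_mono B) auto
    ultimately show ?thesis
      unfolding summation_by_parts[of b t n] sum_distrib_right by linarith
  qed
  then show "\<exists>N. \<forall>n\<ge>N. \<bar>\<Sum>j<n. b j * t j\<bar> \<le> \<bar>b n\<bar> * B + (\<Sum>j<n. \<bar>b j - b (Suc j)\<bar>) * B"
    by blast
qed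

text \<open>
  The closed form \<open>sin\<^sup>2 (n X) / sin X\<close> of \<open>\<Sum>\<^sub>j\<^sub><\<^sub>n sin ((2 j + 1) X)\<close>, where \<open>X = \<pi> (x + 1) / 2\<close>, so that
  \<open>sin X = cos (\<pi> x / 2)\<close>; each term is a telescoping difference.
\<close>

lemma sum_sine_mode_mult_cos:
  "(\<Sum>j<n. sine_mode j x) * cos (pi * x / 2) = (sin (real n * (pi * (x + 1) / 2)))\<^sup>2"
proof (induction n)
  case (Suc n)
  define X where "X = pi * (x + 1) / 2"
  have "pi * x / 2 = X - pi / 2" by (simp add: X_def field_simps)
  then have c: "cos (pi * x / 2) = sin X" by (simp only: cos_diff) simp
  have s: "sine_mode n x = sin (real n * X + (real n * X + X))"
    unfolding sine_mode_def by (rule arg_cong[where f=sin]) (simp add: freq_def X_def field_simps)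
  have X': "real (Suc n) * X = real n * X + X" by (simp add: algebra_simps)
  have "sin (a + (a + X)) * sin X = (sin (a + X))\<^sup>2 - (sin a)\<^sup>2" for a
  proof -
    have "sin (a + (a + X)) * sin X = (cos (2 * a) - cos (2 * (a + X))) / 2"
      by (simp add: sin_times_sin algebra_simps)
    then show ?thesis by (simp only: cos_double_sin) (simp add: field_simps)
  qed
  from this[of "real n * X"] show ?case
    using Suc unfolding X_def[symmetric] X' c sum.lessThan_Suc distrib_right s by simp
qed auto

lemma cos_half_pi_pos:
  assumes "\<bar>x\<bar> < 1" shows "cos (pi * x / 2) > 0"
proof (rule cos_gt_zero_pi)
  have "pi * (- 1) < pi * x" "pi * x < pi * 1"
    using assms mult_strict_left_mono[of "- 1" x pi] mult_strict_left_mono[of x 1 pi] by auto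
  then show "- (pi / 2) < pi * x / 2" "pi * x / 2 < pi / 2" by auto
qed

lemma sum_sine_mode_bound:
  assumes "\<bar>x\<bar> < 1"
  shows "\<bar>\<Sum>j<n. sine_mode j x\<bar> \<le> 1 / cos (pi * x / 2)"
proof -
  have "\<bar>(\<Sum>j<n. sine_mode j x)\<bar> * cos (pi * x / 2) = \<bar>(\<Sum>j<n. sine_mode j x) * cos (pi * x / 2)\<bar>"
    using cos_half_pi_pos[OF assms] by (simp add: abs_mult)
  also have "\<dots> \<le> 1"
    unfolding sum_sine_mode_mult_cos by (simp add: abs_square_le_1)
  finally show ?thesis
    using cos_half_pi_pos[OF assms] by (simp add: field_simps)
qed

lemma sine_mode_edge:
  assumes "\<bar>x\<bar> = 1" shows "sine_mode j x = 0"
proof -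
  have "x = 1 \<or> x = -1" using assms by auto
  moreover have "freq j * (1 + 1) = real (2 * j + 1) * pi" by (simp add: freq_def)
  then have "sin (freq j * (1 + 1)) = 0" by (simp only: sin_npi)
  ultimately show ?thesis by (auto simp: sine_mode_def)
qed

lemma profile_edge:
  assumes "\<bar>y\<bar> = 1" shows "profile j y = 0"
proof -
  have "y = 1 \<or> y = -1" using assms by auto
  then show ?thesis by (auto simp: profile_def cosh_ratio_def sinh_ratio_def tanh_def)
qed

lemma sinh_le_mult_cosh:
  fixes u :: real
  assumes "u \<ge> 0" shows "sinh u \<le> u * cosh u"
proof (cases "u = 0")
  case False
  then have "\<exists>z>0. z < u \<and> sinh u - sinh 0 = (u - 0) * cosh z"
    using assms by (intro MVT2) (auto intro!: derivative_eq_intros)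
  then obtain z where z: "0 < z" "z < u" "sinh u = u * cosh z" by auto
  then show ?thesis using assms by (auto intro!: mult_left_mono simp: cosh_real_nonneg_le_iff)
qed auto

text \<open>
  With \<open>r = \<bar>y\<bar>\<close> and \<open>t = 1 - r\<close> the addition theorem gives
  \<open>w(y) = sinh (a t) / (cosh a)\<^sup>2 + t sinh (a r) / cosh a\<close>. In the first term \<open>sinh (a t)\<close> is at most \<open>a t cosh a\<close>, and
  in the second one \<open>sinh (a r) / cosh a\<close> is \<open>exp (- a t)\<close> up to an error of order \<open>exp (- a)\<close>. Both errors carry
  the factor \<open>t\<close>, so they vanish at the boundary.
\<close>

lemma profile_asymptotics:
  assumes "\<bar>y\<bar> \<le> 1"
  shows "\<bar>profile j y - (1 - \<bar>y\<bar>) * exp (- freq j * (1 - \<bar>y\<bar>))\<bar>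
         \<le> (1 - \<bar>y\<bar>) * (4 * (freq j ^ 1 * exp (- freq j * 1)))"
proof -
  define a r t where "a = freq j" and "r = \<bar>y\<bar>" and "t = 1 - r"
  have a: "a > 1" and r: "0 \<le> r" "r \<le> 1" and t: "0 \<le> t" "t \<le> 1"
    using assms freq_gt_1[of j] by (auto simp: a_def r_def t_def)
  have ch: "cosh a > 0" "cosh a \<noteq> 0" "1 / cosh a \<le> 2 * exp (- a)"
    using inverse_cosh_freq_le[of j] by (simp_all add: a_def)
  have "profile j y = tanh a * (cosh (a * r) / cosh a) - r * (sinh (a * r) / cosh a)"
    by (simp add: profile_def cosh_ratio_def sinh_ratio_def a_def r_def abs_if)
  also have "\<dots> = (sinh a * cosh (a * r) - cosh a * sinh (a * r)) / (cosh a)\<^sup>2 + t * (sinh (a * r) / cosh a)"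
    using ch by (simp add: tanh_def t_def field_simps power2_eq_square)
  also have "sinh a * cosh (a * r) - cosh a * sinh (a * r) = sinh (a * t)"
    by (simp add: t_def right_diff_distrib sinh_diff)
  finally have 1: "profile j y = sinh (a * t) / (cosh a)\<^sup>2 + t * (sinh (a * r) / cosh a)" .
  have "sinh (a * t) \<le> a * t * cosh (a * t)"
    using a t by (intro sinh_le_mult_cosh) auto
  also have "\<dots> \<le> a * t * cosh a"
    using a t by (intro mult_left_mono) (auto simp: cosh_real_nonneg_le_iff mult_left_le)
  finally have "sinh (a * t) / (cosh a)\<^sup>2 \<le> a * t * (1 / cosh a)"
    using ch by (simp add: field_simps power2_eq_square)
  also have "\<dots> \<le> a * t * (2 * exp (- a))"
    using a t by (intro mult_left_mono ch) auto
  finally have 2: "\<bar>sinh (a * t) / (cosh a)\<^sup>2\<bar> \<le> t * (2 * (a * exp (- a)))"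
    using a t by (simp add: algebra_simps)
  have e: "exp (- (a * t)) = exp (a * r) * exp (- a)"
    by (simp add: t_def exp_add[symmetric] algebra_simps)
  have "sinh (a * r) / cosh a - exp (- (a * t)) = - (exp (- (a * r)) + exp (a * r - 2 * a)) / 2 * (1 / cosh a)"
  proof -
    have "sinh (a * r) - exp (- (a * t)) * cosh a = - (exp (- (a * r)) + exp (a * r - 2 * a)) / 2"
      unfolding e sinh_def cosh_def
      by (simp add: algebra_simps exp_add[symmetric])
    then have "(sinh (a * r) - exp (- (a * t)) * cosh a) / cosh a = - (exp (- (a * r)) + exp (a * r - 2 * a)) / 2 / cosh a"
      by (rule arg_cong)
    then show ?thesis using ch by (simp add: diff_divide_distrib)
  qed
  also have "\<dots> = - ((exp (- (a * r)) + exp (a * r - 2 * a)) / 2 * (1 / cosh a))"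
    by (simp only: minus_divide_left mult_minus_left)
  also have "\<bar>\<dots>\<bar> = (exp (- (a * r)) + exp (a * r - 2 * a)) / 2 * (1 / cosh a)"
    unfolding abs_minus_cancel
  proof (rule abs_of_nonneg)
    have "0 \<le> exp (- (a * r)) + exp (a * r - 2 * a)" by (intro add_nonneg_nonneg) simp_all
    then show "0 \<le> (exp (- (a * r)) + exp (a * r - 2 * a)) / 2 * (1 / cosh a)" by simp
  qed
  also have "\<dots> \<le> 1 * (2 * (a * exp (- a)))"
  proof (rule mult_mono)
    have "a * r \<le> 2 * a" "0 \<le> a * r" using mult_left_mono[OF r(2), of a] a r by auto
    then have "exp (- (a * r)) \<le> 1" "exp (a * r - 2 * a) \<le> 1" by auto
    from add_mono[OF this] show "(exp (- (a * r)) + exp (a * r - 2 * a)) / 2 \<le> 1" by simp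
    have "exp (- a) * 1 \<le> exp (- a) * a" using a by (intro mult_left_mono) auto
    then have "2 * exp (- a) \<le> 2 * (a * exp (- a))" by (simp only: mult_1_right mult.commute[of _ a])
    then show "1 / cosh a \<le> 2 * (a * exp (- a))" by (rule order_trans[OF ch(3)])
  qed (use ch in auto)
  finally have 3: "\<bar>sinh (a * r) / cosh a - exp (- (a * t))\<bar> \<le> 2 * (a * exp (- a))" by simp
  have "profile j y - t * exp (- (a * t)) = sinh (a * t) / (cosh a)\<^sup>2 + t * (sinh (a * r) / cosh a - exp (- (a * t)))"
    unfolding 1 by (simp add: algebra_simps)
  also have "\<bar>\<dots>\<bar> \<le> \<bar>sinh (a * t) / (cosh a)\<^sup>2\<bar> + t * \<bar>sinh (a * r) / cosh a - exp (- (a * t))\<bar>"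
    by (rule order_trans[OF abs_triangle_ineq]) (simp add: abs_mult t)
  also have "\<dots> \<le> t * (2 * (a * exp (- a))) + t * (2 * (a * exp (- a)))"
    by (intro add_mono 2 mult_left_mono 3 t)
  finally show ?thesis by (simp add: a_def r_def t_def algebra_simps)
qed

text \<open>
  The first bound compares with the geometric series of the exponentials; the second one uses the cancellation
  among the sines, the exponentials being decreasing and at most one.
\<close>

lemma damped_sine_series_bounds:
  assumes t: "0 < t" "t \<le> 1"
  shows "summable (\<lambda>j. exp (- freq j * t) * sine_mode j x)"
    and "t * \<bar>\<Sum>j. exp (- freq j * t) * sine_mode j x\<bar> \<le> exp (pi / 2)"
    and "\<bar>x\<bar> < 1 \<Longrightarrow> \<bar>\<Sum>j. exp (- freq j * t) * sine_mode j x\<bar> \<le> 1 / cos (pi * x / 2)"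
proof -
  have le: "norm (exp (- freq j * t) * sine_mode j x) \<le> exp (- freq j * t)" for j
    by (simp add: abs_mult sine_mode_def mult_left_le)
  note sm = summable_exp_freq[OF t(1)]
  show s: "summable (\<lambda>j. exp (- freq j * t) * sine_mode j x)"
    by (rule summable_comparison_test'[OF sm]) (rule le)
  have "exp (- freq j * t) = exp (- (pi * t / 2)) * exp (- (pi * t)) ^ j" for j
    by (simp add: freq_def exp_of_nat_mult[symmetric] exp_add[symmetric] algebra_simps add_divide_distrib)
  moreover have "(\<Sum>j. exp (- (pi * t / 2)) * exp (- (pi * t)) ^ j) = exp (- (pi * t / 2)) * (1 / (1 - exp (- (pi * t))))"
    using t by (subst suminf_mult) (auto simp: suminf_geometric summable_geometric)
  ultimately have eq: "(\<Sum>j. exp (- freq j * t)) = exp (- (pi * t / 2)) / (1 - exp (- (pi * t)))"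
    by simp
  have "\<bar>\<Sum>j. exp (- freq j * t) * sine_mode j x\<bar> \<le> (\<Sum>j. exp (- freq j * t))"
    using norm_suminf_le[OF le sm] by simp
  also have "\<dots> \<le> exp (pi / 2) / t"
  proof -
    have "1 + pi * t \<le> exp (pi * t)" by (rule exp_ge_add_one_self)
    then have "(1 + pi * t) * exp (- (pi * t)) \<le> exp (pi * t) * exp (- (pi * t))"
      by (intro mult_right_mono) auto
    then have "pi * t * exp (- (pi * t)) \<le> 1 - exp (- (pi * t))"
      by (simp add: exp_add[symmetric] algebra_simps)
    moreover have "1 * (t * exp (- (pi * t))) \<le> pi * (t * exp (- (pi * t)))"
      using pi_gt3 t by (intro mult_right_mono) auto
    ultimately have "t * exp (- (pi * t)) \<le> 1 - exp (- (pi * t))" by simp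
    moreover have "exp (- (pi * t / 2)) = exp (pi * t / 2) * exp (- (pi * t))"
      by (simp add: exp_add[symmetric])
    moreover have "exp (pi * t / 2) \<le> exp (pi / 2)" using t by simp
    ultimately have "t * exp (- (pi * t / 2)) \<le> exp (pi / 2) * (1 - exp (- (pi * t)))"
      using mult_mono[of "exp (pi * t / 2)" "exp (pi / 2)" "t * exp (- (pi * t))" "1 - exp (- (pi * t))"] t
      by (simp add: algebra_simps)
    moreover have "1 - exp (- (pi * t)) > 0" using t by simp
    ultimately show ?thesis
      unfolding eq using t by (simp add: field_simps)
  qed
  finally show "t * \<bar>\<Sum>j. exp (- freq j * t) * sine_mode j x\<bar> \<le> exp (pi / 2)"
    using t by (simp add: field_simps)
  assume x: "\<bar>x\<bar> < 1"
  have lim: "(\<lambda>j. exp (- freq j * t)) \<longlonglongrightarrow> 0" by (rule summable_LIMSEQ_zero[OF sm])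
  have "exp (- freq (Suc j) * t) \<le> exp (- freq j * t)" for j
    using t by (simp add: freq_def)
  then have "\<bar>exp (- freq j * t) - exp (- freq (Suc j) * t)\<bar> = exp (- freq j * t) - exp (- freq (Suc j) * t)" for j
    by simp
  then have "(\<lambda>j. \<bar>exp (- freq j * t) - exp (- freq (Suc j) * t)\<bar>) sums (exp (- freq 0 * t) - 0)"
    using telescope_sums'[OF lim] by (simp only:)
  from abel_bound[OF sum_sine_mode_bound[OF x] lim this s]
  have "\<bar>\<Sum>j. exp (- freq j * t) * sine_mode j x\<bar> \<le> 1 / cos (pi * x / 2) * exp (- freq 0 * t)" by simp
  also have "\<dots> \<le> 1 / cos (pi * x / 2) * 1"
    using cos_half_pi_pos[OF x] t by (intro mult_left_mono) auto
  finally show "\<bar>\<Sum>j. exp (- freq j * t) * sine_mode j x\<bar> \<le> 1 / cos (pi * x / 2)" by simp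
qed

lemma half_solution_edge:
  assumes "\<bar>x\<bar> = 1 \<or> \<bar>y\<bar> = 1"
  shows "half_solution (x, y) = 0"
  using assms sine_mode_edge profile_edge by (auto simp: half_solution_def product_series_def)

text \<open>
  The main term is \<open>t\<close> times the damped sine series. Its crude bound of order \<open>1 / t\<close> makes the product bounded,
  and its bound by \<open>1 / cos (\<pi> x / 2)\<close>, which is finite for \<open>\<bar>x\<bar> < 1\<close>, makes the product tend to zero on the open sides.
\<close>

lemma half_solution_bounds:
  obtains C where
    "\<And>x y. \<bar>x\<bar> \<le> 1 \<Longrightarrow> \<bar>y\<bar> \<le> 1 \<Longrightarrow> \<bar>half_solution (x, y)\<bar> \<le> C"
    "\<And>x y. \<bar>x\<bar> < 1 \<Longrightarrow> \<bar>y\<bar> \<le> 1 \<Longrightarrow> \<bar>half_solution (x, y)\<bar> \<le> (1 - \<bar>y\<bar>) * (C + 1 / cos (pi * x / 2))"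
proof -
  define D where "D = (\<Sum>j. 4 * (freq j ^ 1 * exp (- freq j * 1)))"
  have sD: "summable (\<lambda>j. 4 * (freq j ^ 1 * exp (- freq j * 1)))"
    by (intro summable_mult summable_power_exp_freq) auto
  have "D \<ge> 0" unfolding D_def by (rule suminf_nonneg[OF sD]) auto
  have main: "\<bar>half_solution (x, y)\<bar> \<le> t * D + t * \<bar>\<Sum>j. exp (- freq j * t) * sine_mode j x\<bar>"
    if y: "\<bar>y\<bar> < 1" and x: "\<bar>x\<bar> \<le> 1" and t: "t = 1 - \<bar>y\<bar>" for x y t
  proof -
    have t': "0 < t" "t \<le> 1" using y t by auto
    define e where "e j = profile j y - t * exp (- freq j * t)" for j
    have e: "norm (sine_mode j x * e j) \<le> t * (4 * (freq j ^ 1 * exp (- freq j * 1)))" for j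
    proof -
      have "norm (sine_mode j x * e j) \<le> \<bar>e j\<bar>"
        by (simp add: abs_mult sine_mode_def mult_left_le_one_le)
      also have "\<dots> \<le> t * (4 * (freq j ^ 1 * exp (- freq j * 1)))"
        unfolding e_def t by (rule profile_asymptotics) (use y in simp)
      finally show ?thesis .
    qed
    have sE: "summable (\<lambda>j. sine_mode j x * e j)"
      by (rule summable_comparison_test'[OF summable_mult[OF sD, of t]]) (rule e)
    have "\<bar>\<Sum>j. sine_mode j x * e j\<bar> \<le> t * D"
      using norm_suminf_le[OF e summable_mult[OF sD, of t]] suminf_mult[OF sD, of t] by (simp add: D_def)
    moreover have "half_solution (x, y) = (\<Sum>j. sine_mode j x * e j) + t * (\<Sum>j. exp (- freq j * t) * sine_mode j x)"
      unfolding suminf_mult[OF damped_sine_series_bounds(1)[OF t'], symmetric]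
        suminf_add[OF sE summable_mult[OF damped_sine_series_bounds(1)[OF t']]]
      by (simp add: half_solution_def product_series_def e_def algebra_simps)
    moreover have "\<bar>t * (\<Sum>j. exp (- freq j * t) * sine_mode j x)\<bar> = t * \<bar>\<Sum>j. exp (- freq j * t) * sine_mode j x\<bar>"
      using t' by (simp add: abs_mult)
    ultimately show ?thesis by linarith
  qed
  define C where "C = D + exp (pi / 2)"
  show ?thesis
  proof (rule that[of C])
    fix x y :: real assume xy: "\<bar>x\<bar> \<le> 1" "\<bar>y\<bar> \<le> 1"
    show "\<bar>half_solution (x, y)\<bar> \<le> C"
    proof (cases "\<bar>y\<bar> = 1")
      case True
      then show ?thesis using half_solution_edge[of x y] \<open>D \<ge> 0\<close> by (simp add: C_def)
    next
      case False
      have "(1 - \<bar>y\<bar>) * D \<le> D" using mult_right_mono[OF _ \<open>D \<ge> 0\<close>, of "1 - \<bar>y\<bar>" 1] by simp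
      then show ?thesis
        using main[OF _ xy(1) refl, of y] damped_sine_series_bounds(2)[of "1 - \<bar>y\<bar>" x] xy False
        by (simp add: C_def)
    qed
  next
    fix x y :: real assume xy: "\<bar>x\<bar> < 1" "\<bar>y\<bar> \<le> 1"
    show "\<bar>half_solution (x, y)\<bar> \<le> (1 - \<bar>y\<bar>) * (C + 1 / cos (pi * x / 2))"
    proof (cases "\<bar>y\<bar> = 1")
      case True
      then show ?thesis using half_solution_edge[of x y] by simp
    next
      case False
      with xy have t: "0 < 1 - \<bar>y\<bar>" "1 - \<bar>y\<bar> \<le> 1" by auto
      have "\<bar>half_solution (x, y)\<bar> \<le> (1 - \<bar>y\<bar>) * D + (1 - \<bar>y\<bar>) * (1 / cos (pi * x / 2))"
        using main[of y x "1 - \<bar>y\<bar>"] t xy mult_left_mono[OF damped_sine_series_bounds(3)[OF t xy(1)], of "1 - \<bar>y\<bar>"]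
        by simp
      also have "\<dots> \<le> (1 - \<bar>y\<bar>) * (C + 1 / cos (pi * x / 2))"
        using t unfolding distrib_left[symmetric] by (intro mult_left_mono) (auto simp: C_def)
      finally show ?thesis .
    qed
  qed
qed

lemma continuous_on_half_solution: "continuous_on (closure Omega - corners) half_solution"
proof (rule continuous_on_eq_continuous_within[THEN iffD2], rule ballI)
  fix p assume p: "p \<in> closure Omega - corners"
  obtain x y where xy: "p = (x, y)" "\<bar>x\<bar> \<le> 1" "\<bar>y\<bar> \<le> 1" and nc: "\<bar>x\<bar> < 1 \<or> \<bar>y\<bar> < 1"
    using p by (cases p) (auto simp: closure_Omega corners_def abs_le_iff abs_less_iff)
  show "continuous (at p within closure Omega - corners) half_solution"
  proof (cases "\<bar>y\<bar> < 1")
    case True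
    have "continuous_on ({-1..1} \<times> {-1<..<1}) half_solution"
      unfolding half_solution_def
      by (intro continuous_on_product_series tempered_sine_mode decaying_profile
          continuous_on_sine_mode continuous_on_profile)
    then have "continuous (at p within {-1..1} \<times> {-1<..<1}) half_solution"
      using True xy unfolding continuous_on_eq_continuous_within by (auto simp: abs_le_iff abs_less_iff)
    moreover have "at p within (closure Omega - corners) = at p within {-1..1} \<times> {-1<..<1}"
    proof (rule at_within_nhd[where S="UNIV \<times> {-1<..<1}"])
      show "p \<in> UNIV \<times> {-1<..<1}" using True xy by (auto simp: abs_less_iff)
      show "open ((UNIV :: real set) \<times> {-1<..<1::real})" by (intro open_Times) auto
    qed (auto simp: closure_Omega corners_def)
    ultimately show ?thesis by simp
  next
    case False
    with xy nc have x: "\<bar>x\<bar> < 1" and y: "\<bar>y\<bar> = 1" by auto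
    obtain C where C: "\<And>x y. \<bar>x\<bar> < 1 \<Longrightarrow> \<bar>y\<bar> \<le> 1 \<Longrightarrow> \<bar>half_solution (x, y)\<bar> \<le> (1 - \<bar>y\<bar>) * (C + 1 / cos (pi * x / 2))"
      using half_solution_bounds by metis
    have "((\<lambda>q. (1 - \<bar>snd q\<bar>) * (C + 1 / cos (pi * fst q / 2))) \<longlongrightarrow> (1 - \<bar>snd p\<bar>) * (C + 1 / cos (pi * fst p / 2)))
        (at p within closure Omega - corners)"
      using cos_half_pi_pos[OF x] xy by (intro tendsto_intros) auto
    then have lim: "((\<lambda>q. (1 - \<bar>snd q\<bar>) * (C + 1 / cos (pi * fst q / 2))) \<longlongrightarrow> 0) (at p within closure Omega - corners)"
      using xy y by simp
    have "p \<in> {-1<..<1} \<times> UNIV" "open ({-1<..<1::real} \<times> (UNIV :: real set))"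
      using xy x by (auto simp: abs_less_iff intro: open_Times)
    then have "\<forall>\<^sub>F q in at p within closure Omega - corners. q \<in> {-1<..<1} \<times> UNIV \<and> q \<in> closure Omega - corners"
      unfolding eventually_conj_iff
      by (auto simp: eventually_at_topological intro!: exI[of _ "{-1<..<1::real} \<times> (UNIV :: real set)"])
    then have "\<forall>\<^sub>F q in at p within closure Omega - corners.
        norm (half_solution q) \<le> (1 - \<bar>snd q\<bar>) * (C + 1 / cos (pi * fst q / 2))"
    proof eventually_elim
      case (elim q)
      then have "\<bar>fst q\<bar> < 1" "\<bar>snd q\<bar> \<le> 1" by (auto simp: closure_Omega)
      from C[OF this] show ?case by simp
    qed
    then have "(half_solution \<longlongrightarrow> 0) (at p within closure Omega - corners)"
      by (rule Lim_null_comparison[OF _ lim])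
    then show ?thesis
      unfolding continuous_within using half_solution_edge[of x y] xy y by simp
  qed
qed

lemma is_h0_solution: "is_h0 s (solution s)"
  unfolding is_h0_def
proof (intro conjI ballI)
  show "C2_on Omega (solution s)" by (rule solution_C2_and_laplacian)
  show "\<And>p. p \<in> Omega \<Longrightarrow> laplacian (solution s) p = - (1 / 6) * (dy (dy (q0 s)) p - dx (dx (q0 s)) p)"
    by (rule solution_C2_and_laplacian)
  obtain C where C: "\<And>x y. \<bar>x\<bar> \<le> 1 \<Longrightarrow> \<bar>y\<bar> \<le> 1 \<Longrightarrow> \<bar>half_solution (x, y)\<bar> \<le> C"
    using half_solution_bounds by metis
  show "bounded (solution s ` Omega)"
    unfolding bounded_iff
  proof (intro exI ballI)
    fix v assume "v \<in> solution s ` Omega"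
    then obtain x y where "(x, y) \<in> Omega" and v: "v = solution s (x, y)" by auto
    then have xy: "\<bar>x\<bar> \<le> 1" "\<bar>y\<bar> \<le> 1" by (auto simp: Omega_def)
    have "\<bar>half_solution (x, y) + half_solution (y, x)\<bar> \<le> 2 * C"
      using C[OF xy] C[OF xy(2,1)] by linarith
    then show "norm v \<le> \<bar>s / 6\<bar> * (2 * C)"
      unfolding v solution_def prod.case mult_1 real_norm_def abs_mult by (intro mult_left_mono) auto
  qed
  have "continuous_on (closure Omega - corners) (half_solution \<circ> prod.swap)"
    by (intro continuous_on_compose continuous_on_swap continuous_on_subset[OF continuous_on_half_solution])
      (auto simp: closure_Omega corners_def)
  then have "continuous_on (closure Omega - corners) (\<lambda>p. s / 6 * (half_solution p + (half_solution \<circ> prod.swap) p))"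
    by (rule continuous_on_mult_left[OF continuous_on_add[OF continuous_on_half_solution]])
  moreover have "(\<lambda>p. s / 6 * (half_solution p + (half_solution \<circ> prod.swap) p)) = solution s"
    by (auto simp: solution_def)
  ultimately show "continuous_on (closure Omega - corners) (solution s)" by (simp only:)
  fix p assume "p \<in> frontier Omega - corners"
  then have "p \<in> closure Omega" "p \<notin> Omega" by (simp_all add: frontier_Omega)
  then obtain x y where "p = (x, y)" "\<bar>x\<bar> = 1 \<or> \<bar>y\<bar> = 1"
    unfolding closure_Omega by (cases p) (auto simp: Omega_def)
  then show "solution s p = 0"
    using half_solution_edge[of x y] half_solution_edge[of y x] by (auto simp: solution_def)
qed

text \<open>
  The difference of two solutions is harmonic and bounded and vanishes on the open sides.
\<close>

lemma is_h0_le: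
  assumes h: "is_h0 s h" and k: "is_h0 s k" and p: "p \<in> Omega"
  shows "h p \<le> k p"
proof -
  note H = h[unfolded is_h0_def] and K = k[unfolded is_h0_def]
  have lin: "has_partials_on Omega (\<lambda>q. 1 * (f q + (- 1) * g q)) (\<lambda>q. 1 * (fx q + (- 1) * gx q)) (\<lambda>q. 1 * (fy q + (- 1) * gy q))"
    if "has_partials_on Omega f fx fy" "has_partials_on Omega g gx gy" for f g fx gx fy gy
    using that by (rule has_partials_on_lincomb)
  note D = lin[OF C2_onD(1) C2_onD(1)] lin[OF C2_onD(2) C2_onD(2)] lin[OF C2_onD(3) C2_onD(3)]
  obtain M where M: "\<And>q. q \<in> Omega \<Longrightarrow> \<bar>h q\<bar> \<le> M" using H by (auto simp: bounded_iff)
  obtain N where N: "\<And>q. q \<in> Omega \<Longrightarrow> \<bar>k q\<bar> \<le> N" using K by (auto simp: bounded_iff)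
  have "1 * (h p + (- 1) * k p) \<le> 0"
  proof (rule bounded_harmonic_nonpos[OF D])
    show "1 * (dx (dx h) q + (- 1) * dx (dx k) q) + 1 * (dy (dy h) q + (- 1) * dy (dy k) q) = 0" if "q \<in> Omega" for q
    proof -
      have "laplacian h q = laplacian k q" using H K that by simp
      then show ?thesis by (simp add: laplacian_def)
    qed
    show "1 * (h q + (- 1) * k q) \<le> M + N" if "q \<in> Omega" for q
      using M[OF that] N[OF that] by (simp add: abs_le_iff)
    show "continuous_on (closure Omega - corners) (\<lambda>q. 1 * (h q + (- 1) * k q))"
      using H K by (intro continuous_intros) auto
  qed (use H K p in auto)
  then show ?thesis by simp
qed

lemma is_h0_unique:
  assumes "is_h0 s h" "p \<in> closure Omega - corners"
  shows "h p = solution s p"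
proof (cases "p \<in> Omega")
  case True
  show ?thesis
    using is_h0_le[OF assms(1) is_h0_solution True] is_h0_le[OF is_h0_solution assms(1) True] by (rule antisym)
next
  case False
  then have "p \<in> frontier Omega - corners" using assms by (simp add: frontier_Omega)
  then show ?thesis using assms(1) is_h0_solution[of s] by (simp add: is_h0_def)
qed

section \<open>Sine expansion of the profiles\<close>

text \<open>
  Multiplication by \<open>cos t\<close> stays within the span of the sines. This lets orthogonality to all sines pass to
  products with polynomials in \<open>cos t\<close>.
\<close>

lemma sin_mult_cos_recurrence:
  assumes "n > 0"
  shows "sin (real n * t) * cos t = (sin (real (Suc n) * t) + sin (real (n - 1) * t)) / 2"
proof (cases n)
  case (Suc k)
  have "real (Suc n) * t = real n * t + t" "real (n - 1) * t = real n * t - t"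
    using Suc by (simp_all add: algebra_simps)
  then show ?thesis by (simp only: sin_add sin_diff) simp
qed (use assms in simp)

definition sine :: "nat \<Rightarrow> real \<Rightarrow> real" where
  "sine n y = sin (real n * (pi * (y + 1) / 2))"

lemma continuous_on_sine [continuous_intros]: "continuous_on S (sine n)"
  unfolding sine_def by (intro continuous_intros) auto

text \<open>
  With \<open>\<theta> = \<pi> (y + 1) / 2\<close>, orthogonality of \<open>g\<close> to all sines means that \<open>G = g sin \<theta>\<close> is orthogonal to all
  polynomials in \<open>cos \<theta>\<close>. As \<open>cos \<theta>\<close> is injective on \<open>[-1, 1]\<close>, these are dense among the continuous functions by
  the Stone-Weierstrass theorem. Hence \<open>G\<close> is orthogonal to itself.
\<close>

lemma sine_orthogonal_imp_zero:
  assumes g: "continuous_on {-1..1} g"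
    and orth: "\<And>n. n > 0 \<Longrightarrow> integral {-1..1} (\<lambda>y. g y * sine n y) = 0"
    and y: "\<bar>y\<bar> < 1"
  shows "g y = 0"
proof -
  define \<theta> where "\<theta> y = pi * (y + 1) / 2" for y :: real
  have sine: "sine n y = sin (real n * \<theta> y)" for n y by (simp add: sine_def \<theta>_def)
  have cont_\<theta>: "continuous_on S \<theta>" for S unfolding \<theta>_def by (intro continuous_intros) auto
  have step: "((\<lambda>y. g y * sine n y * poly p (cos (\<theta> y))) has_integral 0) {-1..1}" for n p
  proof (induction p arbitrary: n)
    case (pCons a p)
    show ?case
    proof (cases "n = 0")
      case False
      then have n: "n > 0" by simp
      have eq: "g y * sine n y * poly (pCons a p) (cos (\<theta> y)) = a * (g y * sine n y)
          + 1 / 2 * (g y * sine (Suc n) y * poly p (cos (\<theta> y)) + g y * sine (n - 1) y * poly p (cos (\<theta> y)))" for y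
      proof -
        have "g y * sine n y * poly (pCons a p) (cos (\<theta> y))
            = a * (g y * sine n y) + g y * (sine n y * cos (\<theta> y)) * poly p (cos (\<theta> y))"
          by (simp add: algebra_simps)
        then show ?thesis
          unfolding sine sin_mult_cos_recurrence[OF n] by (simp add: algebra_simps)
      qed
      have "(\<lambda>y. g y * sine n y) integrable_on {-1..1}"
        by (intro integrable_continuous_interval continuous_intros g)
      then have "((\<lambda>y. g y * sine n y) has_integral 0) {-1..1}"
        using orth[OF n] integrable_integral by metis
      from has_integral_add[OF has_integral_mult_right[OF this, of a]
          has_integral_mult_right[OF has_integral_add[OF pCons.IH pCons.IH], of "1 / 2" "Suc n" "n - 1"]]
      show ?thesis unfolding eq by simp
    qed (simp add: sine_def)
  qed simp
  define G where "G y = g y * sine 1 y" for y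
  have contG: "continuous_on {-1..1} G" unfolding G_def by (intro continuous_intros g)
  have "integral {-1..1} (\<lambda>y. G y * G y) = 0"
  proof (rule ccontr)
    define I where "I = integral {-1..1} (\<lambda>y. G y * G y)"
    define J where "J = integral {-1..1} (\<lambda>y. \<bar>G y\<bar>)"
    assume "integral {-1..1} (\<lambda>y. G y * G y) \<noteq> 0"
    moreover have "I \<ge> 0" unfolding I_def
      by (intro integral_nonneg integrable_continuous_interval continuous_intros contG) auto
    ultimately have "I > 0" by (simp add: I_def)
    have "J \<ge> 0" unfolding J_def
      by (intro integral_nonneg integrable_continuous_interval continuous_intros contG) auto
    \<comment> \<open>small enough for \<open>e J < I\<close>; the summand one covers the case \<open>J = 0\<close>\<close>
    define e where "e = I / (2 * (J + 1))"
    have "e > 0" using \<open>I > 0\<close> \<open>J \<ge> 0\<close> by (simp add: e_def)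
    have "\<exists>f. (\<exists>p. f = (\<lambda>y. poly p (cos (\<theta> y)))) \<and> (\<forall>y\<in>{-1..1}. \<bar>G y - f y\<bar> < e)"
    proof (rule Stone_Weierstrass_HOL)
      show "\<exists>p. (\<lambda>y. c) = (\<lambda>y. poly p (cos (\<theta> y)))" for c :: real
        by (rule exI[of _ "[:c:]"]) simp
      show "continuous_on {-1..1} f" if "\<exists>p. f = (\<lambda>y. poly p (cos (\<theta> y)))" for f
        using that by (auto intro!: continuous_intros cont_\<theta>)
      show "\<exists>p. (\<lambda>y. f y + h y) = (\<lambda>y. poly p (cos (\<theta> y)))"
        if "(\<exists>p. f = (\<lambda>y. poly p (cos (\<theta> y)))) \<and> (\<exists>p. h = (\<lambda>y. poly p (cos (\<theta> y))))" for f h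
        using that by (metis poly_add)
      show "\<exists>p. (\<lambda>y. f y * h y) = (\<lambda>y. poly p (cos (\<theta> y)))"
        if "(\<exists>p. f = (\<lambda>y. poly p (cos (\<theta> y)))) \<and> (\<exists>p. h = (\<lambda>y. poly p (cos (\<theta> y))))" for f h
        using that by (metis poly_mult)
      show "\<exists>f. (\<exists>p. f = (\<lambda>y. poly p (cos (\<theta> y)))) \<and> f x \<noteq> f y"
        if "x \<in> {-1..1} \<and> y \<in> {-1..1} \<and> x \<noteq> y" for x y
      proof -
        have range: "0 \<le> \<theta> z \<and> \<theta> z \<le> pi" if "z \<in> {-1..1}" for z
          using that mult_left_mono[of "z + 1" 2 pi] by (auto simp: \<theta>_def)
        have "\<theta> x \<noteq> \<theta> y" using that by (simp add: \<theta>_def)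
        then have "cos (\<theta> x) \<noteq> cos (\<theta> y)"
          using cos_inj_pi[of "\<theta> x" "\<theta> y"] range that by blast
        then show ?thesis by (intro exI[of _ "\<lambda>y. cos (\<theta> y)"] conjI exI[of _ "[:0, 1:]"]) auto
      qed
    qed (use contG \<open>e > 0\<close> in auto)
    then obtain f p where f: "f = (\<lambda>y. poly p (cos (\<theta> y)))" "\<forall>y\<in>{-1..1}. \<bar>G y - f y\<bar> < e"
      by (elim exE conjE)
    then have p: "\<And>y. y \<in> {-1..1} \<Longrightarrow> \<bar>G y - poly p (cos (\<theta> y))\<bar> < e" by simp
    have contp: "continuous_on {-1..1} (\<lambda>y. poly p (cos (\<theta> y)))"
      by (intro continuous_intros cont_\<theta>)
    have "I = integral {-1..1} (\<lambda>y. G y * G y - G y * poly p (cos (\<theta> y)))"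
      using integral_unique[OF step[of 1 p], folded G_def]
      by (subst integral_diff) (auto simp: I_def intro!: integrable_continuous_interval continuous_intros contG contp)
    also have "\<dots> \<le> integral {-1..1} (\<lambda>y. e * \<bar>G y\<bar>)"
    proof (rule integral_le)
      fix y :: real assume "y \<in> {-1..1}"
      have "G y * G y - G y * poly p (cos (\<theta> y)) \<le> \<bar>G y\<bar> * \<bar>G y - poly p (cos (\<theta> y))\<bar>"
        by (metis abs_ge_self abs_mult right_diff_distrib)
      also have "\<dots> \<le> \<bar>G y\<bar> * e"
        using p[OF \<open>y \<in> {-1..1}\<close>] by (intro mult_left_mono) auto
      finally show "G y * G y - G y * poly p (cos (\<theta> y)) \<le> e * \<bar>G y\<bar>" by (simp add: mult.commute)
    qed (auto intro!: integrable_continuous_interval continuous_intros contG contp)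
    also have "\<dots> = e * J" by (simp add: J_def)
    also have "\<dots> < I"
      using \<open>I > 0\<close> \<open>J \<ge> 0\<close> by (simp add: e_def field_simps add_nonneg_pos)
    finally show False by simp
  qed
  then have "\<forall>y\<in>{-1..1}. G y * G y = 0"
    by (subst (asm) integral_eq_0_iff) (auto intro!: continuous_intros contG)
  moreover have "y \<in> {-1..1}" using y by auto
  ultimately have "g y * sine 1 y = 0" unfolding G_def by fastforce
  moreover have "sine 1 y = cos (pi * y / 2)"
  proof -
    have "sine 1 y = sin (pi * y / 2 + pi / 2)"
      unfolding sine_def by (rule arg_cong[where f=sin]) (simp add: field_simps)
    then show ?thesis by (simp add: sin_add)
  qed
  ultimately show ?thesis using cos_half_pi_pos[OF y] by simp
qed

lemma has_integral_DERIV: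
  fixes F :: "real \<Rightarrow> real"
  assumes "a \<le> b" "\<And>x. (F has_real_derivative f x) (at x)"
  shows "(f has_integral (F b - F a)) {a..b}"
  using assms by (intro fundamental_theorem_of_calculus)
    (auto simp flip: has_real_derivative_iff_has_vector_derivative intro: DERIV_subset)

lemma integral_cosine:
  fixes k :: int
  shows "((\<lambda>y. cos (of_int k * (pi * (y + 1) / 2))) has_integral (if k = 0 then 2 else 0)) {-1..1}"
proof (cases "k = 0")
  case True
  then show ?thesis using has_integral_const_real[of "1::real" "-1" 1] by simp
next
  case False
  define b where "b = of_int k * pi / 2"
  have "b \<noteq> 0" using False by (simp add: b_def)
  have "((\<lambda>y. cos (b * (y + 1))) has_integral (sin (b * (1 + 1)) / b - sin (b * (- 1 + 1)) / b)) {-1..1}"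
    using \<open>b \<noteq> 0\<close> by (intro has_integral_DERIV) (auto intro!: derivative_eq_intros)
  moreover have "sin (b * 2) = 0" unfolding sin_zero_iff_int2 b_def by (rule exI[of _ k]) simp
  ultimately have int: "((\<lambda>y. cos (b * (y + 1))) has_integral 0) {-1..1}" by simp
  have eq: "of_int k * (pi * (y + 1) / 2) = b * (y + 1)" for y by (simp add: b_def)
  show ?thesis unfolding eq using int False by simp
qed

lemma sine_mode_eq_sine: "sine_mode l y = sine (2 * l + 1) y"
  unfolding sine_mode_def sine_def freq_def by (rule arg_cong[where f=sin]) simp

lemma integral_sine_mode_sine:
  assumes "n > 0"
  shows "((\<lambda>y. sine_mode l y * sine n y) has_integral (if n = 2 * l + 1 then 1 else 0)) {-1..1}"
proof -
  define m where "m = 2 * l + 1"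
  have "((\<lambda>y. (cos (of_int (int m - int n) * (pi * (y + 1) / 2)) - cos (of_int (int m + int n) * (pi * (y + 1) / 2))) / 2)
      has_integral ((if int m - int n = 0 then 2 else 0) - (if int m + int n = 0 then 2 else 0)) / 2) {-1..1}"
    by (intro has_integral_divide has_integral_diff integral_cosine)
  moreover have "(cos (of_int (int m - int n) * t) - cos (of_int (int m + int n) * t)) / 2 = sin (real m * t) * sin (real n * t)" for t
    by (simp add: sin_times_sin algebra_simps)
  ultimately have "((\<lambda>y. sine m y * sine n y)
      has_integral ((if int m - int n = 0 then 2 else 0) - (if int m + int n = 0 then 2 else 0)) / 2) {-1..1}"
    unfolding sine_def by (simp only:)
  moreover have "int m - int n = 0 \<longleftrightarrow> n = 2 * l + 1" "int m + int n \<noteq> 0"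
    using assms by (auto simp: m_def)
  ultimately show ?thesis
    unfolding sine_mode_eq_sine m_def[symmetric] by (simp split: if_splits)
qed

text \<open>
  The coefficient of \<^term>\<open>sine_mode l\<close> in the sine expansion of \<^term>\<open>profile j\<close>.
\<close>

definition coef :: "nat \<Rightarrow> nat \<Rightarrow> real" where
  "coef j l = 4 * freq j * freq l / ((freq j)\<^sup>2 + (freq l)\<^sup>2)\<^sup>2"

lemma freq_sq_sum_pos: "(freq j)\<^sup>2 + b\<^sup>2 > 0"
  by (simp add: add_pos_nonneg)

text \<open>
  Green's identity for \<open>w\<close> and \<open>s = sin (\<beta> (y + 1))\<close> gives
  \<open>(w' s - w s')' = (a\<^sup>2 + \<beta>\<^sup>2) w s - 2 a C s\<close> with \<open>C = cosh (a y) / cosh a\<close>, and \<open>(C' s - C s')' = (a\<^sup>2 + \<beta>\<^sup>2) C s\<close>.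
  Together they produce an explicit antiderivative of \<open>w s\<close>, to which only the values \<open>C = 1\<close> at the two ends
  contribute.
\<close>

lemma integral_profile_sine:
  assumes "n > 0"
  shows "((\<lambda>y. profile j y * sine n y) has_integral (if odd n then coef j (n div 2) else 0)) {-1..1}"
proof -
  define a \<beta> where "a = freq j" and "\<beta> = real n * pi / 2"
  define D where "D = a\<^sup>2 + \<beta>\<^sup>2"
  have "D > 0" unfolding D_def a_def by (rule freq_sq_sum_pos)
  define s s' where "s y = sin (\<beta> * (y + 1))" and "s' y = \<beta> * cos (\<beta> * (y + 1))" for y
  have s: "(s has_real_derivative s' y) (at y)" "(s' has_real_derivative - (\<beta>\<^sup>2) * s y) (at y)" for y
    unfolding s_def s'_def by (auto intro!: derivative_eq_intros simp: power2_eq_square)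
  define \<kappa> r where "\<kappa> = 2 * a / D" and "r = 1 / D"
  define F where "F y = ((profile' j y * s y - profile j y * s' y)
      + \<kappa> * (a * sinh_ratio j y * s y - cosh_ratio j y * s' y)) * r" for y
  have "(F has_real_derivative profile j y * s y) (at y)" for y
  proof -
    have "(F has_real_derivative ((profile'' j y * s y + \<beta>\<^sup>2 * (profile j y * s y))
        + \<kappa> * (a\<^sup>2 * cosh_ratio j y * s y + \<beta>\<^sup>2 * (cosh_ratio j y * s y))) * r) (at y)"
      unfolding F_def a_def
      by (auto intro!: derivative_eq_intros s DERIV_profile DERIV_ratios simp: algebra_simps power2_eq_square)
    moreover have "a\<^sup>2 * cosh_ratio j y * s y + \<beta>\<^sup>2 * (cosh_ratio j y * s y) = D * (cosh_ratio j y * s y)"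
      by (simp add: D_def algebra_simps)
    moreover have "profile'' j y * s y + \<beta>\<^sup>2 * (profile j y * s y) + 2 * a * (cosh_ratio j y * s y) = D * (profile j y * s y)"
      by (simp add: D_def profile''_def profile_def a_def algebra_simps)
    ultimately show ?thesis using \<open>D > 0\<close> by (simp add: \<kappa>_def r_def mult.assoc)
  qed
  then have "((\<lambda>y. profile j y * s y) has_integral (F 1 - F (- 1))) {-1..1}"
    by (intro has_integral_DERIV) auto
  moreover have "F 1 - F (- 1) = 2 * a * (s' (- 1) - s' 1) / D\<^sup>2"
  proof -
    have "s 1 = 0" "s (- 1) = 0"
      unfolding s_def \<beta>_def using sin_npi[of n] by (simp_all add: mult.commute)
    moreover have "cosh_ratio j 1 = 1" "cosh_ratio j (- 1) = 1" by (simp_all add: cosh_ratio_def)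
    ultimately show ?thesis
      using \<open>D > 0\<close> by (simp add: F_def profile_edge \<kappa>_def r_def power2_eq_square field_simps)
  qed
  moreover have "s' (- 1) - s' 1 = (if odd n then 2 * \<beta> else 0)"
    using cos_npi[of n] by (auto simp: s'_def \<beta>_def mult.commute)
  moreover have "\<beta> = freq (n div 2)" if "odd n"
    using that by (auto simp: \<beta>_def freq_def elim!: oddE)
  moreover have "s y = sine n y" for y
    by (simp add: s_def sine_def \<beta>_def mult.assoc)
  ultimately show ?thesis
    by (auto simp: coef_def a_def D_def mult.assoc split: if_splits)
qed

lemma freq_ge_Suc: "real (Suc l) \<le> freq l"
proof -
  have "real (2 * l + 1) * (3 / 2) \<le> real (2 * l + 1) * (pi / 2)"
    using pi_gt3 by (intro mult_left_mono) auto
  then show ?thesis by (simp add: freq_def)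
qed

lemma coef_bound: "\<bar>coef j l\<bar> \<le> 4 * freq j * inverse (real (Suc l) ^ 2)"
proof -
  have f: "real (Suc l) \<le> freq l" "1 \<le> freq l" using freq_ge_Suc[of l] by auto
  have "freq l * (real (Suc l))\<^sup>2 \<le> freq l ^ 2 * freq l ^ 2"
    using f by (intro mult_mono power_mono) (auto simp: power2_eq_square)
  also have "\<dots> = (0 + (freq l)\<^sup>2)\<^sup>2" by (simp add: power2_eq_square)
  also have "\<dots> \<le> ((freq j)\<^sup>2 + (freq l)\<^sup>2)\<^sup>2" by (intro power_mono add_right_mono) auto
  finally have "freq l / ((freq j)\<^sup>2 + (freq l)\<^sup>2)\<^sup>2 \<le> inverse (real (Suc l) ^ 2)"
    using freq_sq_sum_pos[of j "freq l"] by (simp add: field_simps del: of_nat_Suc)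
  then have "4 * freq j * (freq l / ((freq j)\<^sup>2 + (freq l)\<^sup>2)\<^sup>2) \<le> 4 * freq j * inverse (real (Suc l) ^ 2)"
    by (intro mult_left_mono) auto
  moreover have "coef j l \<ge> 0" by (simp add: coef_def)
  ultimately show ?thesis by (simp add: coef_def)
qed

lemma summable_inverse_Suc_squares: "summable (\<lambda>l. inverse (real (Suc l) ^ 2))"
  using inverse_power_summable[of 2, where ?'a = real] by (subst summable_Suc_iff) simp

text \<open>
  The coefficients are summable, so the sine series converges uniformly to a continuous function; its integrals
  against all sines are those of the profile.
\<close>

lemma profile_sine_expansion:
  assumes "\<bar>y\<bar> < 1"
  shows "(\<lambda>l. coef j l * sine_mode l y) sums profile j y"
proof -
  define W where "W y = (\<Sum>l. coef j l * sine_mode l y)" for y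
  have le: "norm (coef j l * sine_mode l y) \<le> 4 * freq j * inverse (real (Suc l) ^ 2)" for l y
    unfolding real_norm_def abs_mult
    by (rule order_trans[OF mult_left_le coef_bound]) (auto simp: sine_mode_def)
  have sm: "summable (\<lambda>l. 4 * freq j * inverse (real (Suc l) ^ 2))"
    by (intro summable_mult summable_inverse_Suc_squares)
  have ul: "uniform_limit {-1..1} (\<lambda>N y. \<Sum>l<N. coef j l * sine_mode l y) W sequentially"
    unfolding W_def by (rule Weierstrass_m_test[OF le sm])
  have cont: "continuous_on {-1..1} (\<lambda>y. \<Sum>l<N. coef j l * sine_mode l y)" for N
    by (intro continuous_intros continuous_on_subset[OF continuous_on_sine_mode]) auto
  have contW: "continuous_on {-1..1} W"
    by (rule uniform_limit_theorem[OF _ ul]) (auto intro: always_eventually cont)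
  have intW: "integral {-1..1} (\<lambda>y. W y * sine n y) = (if odd n then coef j (n div 2) else 0)" if "n > 0" for n
  proof -
    have "bounded (sine n ` {-1..1})" by (auto simp: bounded_iff sine_def intro!: exI[of _ 1])
    moreover have "bounded (W ` {-1..1})"
      using compact_continuous_image[OF contW] compact_imp_bounded by blast
    ultimately have ul': "uniform_limit {-1..1} (\<lambda>N y. (\<Sum>l<N. coef j l * sine_mode l y) * sine n y) (\<lambda>y. W y * sine n y) sequentially"
      by (intro uniform_lim_mult ul uniform_limit_const)
    have cont': "continuous_on {-1..1} (\<lambda>y. (\<Sum>l<N. coef j l * sine_mode l y) * sine n y)" for N
      by (intro continuous_on_mult cont continuous_on_sine)
    obtain I J where IJ: "\<And>N. ((\<lambda>y. (\<Sum>l<N. coef j l * sine_mode l y) * sine n y) has_integral I N) {-1..1}"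
      "((\<lambda>y. W y * sine n y) has_integral J) {-1..1}" "I \<longlonglongrightarrow> J"
      using uniform_limit_integral[OF ul' cont' sequentially_bot] by blast
    have "((\<lambda>y. \<Sum>l<N. coef j l * (sine_mode l y * sine n y)) has_integral (\<Sum>l<N. coef j l * (if n = 2 * l + 1 then 1 else 0))) {-1..1}" for N
      by (intro has_integral_sum has_integral_mult_right integral_sine_mode_sine that) auto
    then have "I N = (\<Sum>l<N. coef j l * (if n = 2 * l + 1 then 1 else 0))" for N
      using IJ(1)[of N] by (auto simp: sum_distrib_right mult.assoc intro: has_integral_unique)
    moreover have "(\<Sum>l<N. coef j l * (if n = 2 * l + 1 then 1 else 0)) = (if odd n then coef j (n div 2) else 0)" if "N > n" for N
    proof (cases "odd n")
      case True
      then have "(\<Sum>l<N. coef j l * (if n = 2 * l + 1 then 1 else 0)) = (\<Sum>l<N. if l = n div 2 then coef j l else 0)"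
        by (intro sum.cong) (auto elim!: oddE)
      then show ?thesis using True that by simp
    next
      case False
      then show ?thesis by (intro trans[OF sum.neutral]) auto
    qed
    ultimately have "I N = (if odd n then coef j (n div 2) else 0)" if "N > n" for N
      using that by simp
    then have "\<forall>\<^sub>F N in sequentially. I N = (if odd n then coef j (n div 2) else 0)"
      using eventually_gt_at_top[of n] by (rule eventually_mono[rotated])
    then have "I \<longlonglongrightarrow> (if odd n then coef j (n div 2) else 0)"
      by (rule tendsto_eventually)
    then have "J = (if odd n then coef j (n div 2) else 0)"
      using IJ(3) LIMSEQ_unique by blast
    then show ?thesis using IJ(2) by (auto intro: integral_unique)
  qed
  have contp: "continuous_on {-1..1} (profile j)"
    using continuous_on_profile continuous_on_subset by blast
  have "profile j y - W y = 0"
  proof (rule sine_orthogonal_imp_zero[where g="\<lambda>y. profile j y - W y", OF _ _ assms])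
    show "continuous_on {-1..1} (\<lambda>y. profile j y - W y)" by (intro continuous_intros contp contW)
    show "integral {-1..1} (\<lambda>y. (profile j y - W y) * sine n y) = 0" if "n > 0" for n
    proof -
      have "integral {-1..1} (\<lambda>y. profile j y * sine n y - W y * sine n y)
          = integral {-1..1} (\<lambda>y. profile j y * sine n y) - integral {-1..1} (\<lambda>y. W y * sine n y)"
        by (intro integral_diff integrable_continuous_interval continuous_intros contp contW)
      then show ?thesis
        unfolding intW[OF that] integral_unique[OF integral_profile_sine[OF that]] by (simp add: algebra_simps)
    qed
  qed
  moreover have "(\<lambda>l. coef j l * sine_mode l y) sums W y"
    unfolding W_def by (rule summable_sums[OF summable_comparison_test'[OF sm]]) (rule le)
  ultimately show ?thesis by simp
qed

section \<open>Convergence of the rectangular partial sums\<close>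

text \<open>
  The exponent lies below \<open>-1\<close>, which makes the sequence summable, and twice the exponent is \<open>-3\<close>, the degree of
  homogeneity of the bound \<open>a / (a\<^sup>2 + b\<^sup>2)\<^sup>2\<close> for the differences of the coefficients.
\<close>

definition decay :: "nat \<Rightarrow> real" where
  "decay j = freq j powr (- 3 / 2)"

lemma decay_nonneg: "decay j \<ge> 0"
  by (simp add: decay_def)

lemma summable_decay: "summable decay"
proof (rule summable_comparison_test')
  show "summable (\<lambda>j. real (Suc j) powr (- 3 / 2))"
    using summable_real_powr_iff[of "- 3 / 2"] by (subst summable_Suc_iff) simp
  show "norm (decay j) \<le> real (Suc j) powr (- 3 / 2)" for j
    using freq_ge_Suc[of j] unfolding decay_def by (simp add: powr_mono2')
qed

text \<open>
  Since \<open>a\<^sup>2\<close> and \<open>b\<^sup>2\<close> are at most \<open>D = a\<^sup>2 + b\<^sup>2\<close>, the product \<open>a\<^sup>5\<^sup>/\<^sup>2 b\<^sup>3\<^sup>/\<^sup>2\<close> is at most \<open>D\<^sup>5\<^sup>/\<^sup>4 D\<^sup>3\<^sup>/\<^sup>4 = D\<^sup>2\<close>.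
\<close>

lemma linear_over_quartic_le:
  fixes a b :: real
  assumes "a > 0" "b > 0"
  shows "a / (a\<^sup>2 + b\<^sup>2)\<^sup>2 \<le> a powr (- 3 / 2) * b powr (- 3 / 2)"
proof -
  define D where "D = a\<^sup>2 + b\<^sup>2"
  have D: "D > 0" "a\<^sup>2 \<le> D" "b\<^sup>2 \<le> D" using assms by (auto simp: D_def add_pos_pos)
  have "a * a powr (3 / 2) = a powr (5 / 2)" using assms powr_add[of a 1 "3 / 2"] by simp
  also have "\<dots> = (a\<^sup>2) powr (5 / 4)" using assms by (simp add: powr_powr flip: powr_numeral)
  finally have a: "a * a powr (3 / 2) = (a\<^sup>2) powr (5 / 4)" .
  have b: "b powr (3 / 2) = (b\<^sup>2) powr (3 / 4)" using assms by (simp add: powr_powr flip: powr_numeral)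
  have "a * (a powr (3 / 2) * b powr (3 / 2)) = (a\<^sup>2) powr (5 / 4) * (b\<^sup>2) powr (3 / 4)"
    by (simp only: mult.assoc[symmetric] a b)
  also have "\<dots> \<le> D powr (5 / 4) * D powr (3 / 4)"
    using D by (intro mult_mono powr_mono2) auto
  also have "\<dots> = D\<^sup>2"
    using D by (simp add: powr_add[symmetric])
  finally have "a * (a powr (3 / 2) * b powr (3 / 2)) \<le> D\<^sup>2" .
  then show ?thesis
    using assms D unfolding D_def[symmetric] by (simp add: powr_minus field_simps)
qed

text \<open>
  The derivative of \<open>4 a z / (a\<^sup>2 + z\<^sup>2)\<^sup>2\<close> in \<open>z\<close> is at most \<open>12 a / (a\<^sup>2 + z\<^sup>2)\<^sup>2\<close>, one order smaller than the function
  itself. The bound splits into a product of summable sequences, so the differences are absolutely summable over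
  both indices.
\<close>

lemma coef_variation_bound:
  "\<bar>coef i l - coef i (Suc l)\<bar> \<le> 12 * pi * decay i * decay l"
proof -
  define a b where "a = freq i" and "b = freq l"
  have ab: "a > 0" "b > 0" by (simp_all add: a_def b_def)
  define c where "c z = 4 * a * z / (a\<^sup>2 + z\<^sup>2)\<^sup>2" for z :: real
  define c' where "c' z = 4 * a * (a\<^sup>2 - 3 * z\<^sup>2) / (a\<^sup>2 + z\<^sup>2) ^ 3" for z :: real
  have sq: "a\<^sup>2 + z\<^sup>2 > 0" for z using ab by (simp add: add_pos_nonneg)
  have "(c has_real_derivative c' z) (at z)" for z
  proof -
    define R where "R = a\<^sup>2 + z\<^sup>2"
    have R: "R \<noteq> 0" using sq[of z] unfolding R_def by linarith
    have "(c has_real_derivative (4 * a * R\<^sup>2 - 4 * a * z * (2 * R * (2 * z))) / (R\<^sup>2 * R\<^sup>2)) (at z)"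
      unfolding c_def R_def using sq[of z] by (auto intro!: derivative_eq_intros)
    moreover have "(4 * a * R\<^sup>2 - 4 * a * z * (2 * R * (2 * z))) = R * (4 * a * (R - 4 * z\<^sup>2))"
      by (simp add: power2_eq_square algebra_simps)
    moreover have "R * (4 * a * (R - 4 * z\<^sup>2)) / (R\<^sup>2 * R\<^sup>2) = 4 * a * (R - 4 * z\<^sup>2) / R ^ 3"
      using R by (simp add: power2_eq_square power3_eq_cube)
    ultimately show ?thesis by (simp add: c'_def R_def)
  qed
  then obtain z where z: "b < z" "z < b + pi" "c (b + pi) - c b = (b + pi - b) * c' z"
    using MVT2[of b "b + pi" c c'] by auto
  have "\<bar>c' z\<bar> \<le> 12 * (a / (a\<^sup>2 + b\<^sup>2)\<^sup>2)"
  proof -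
    have "\<bar>a\<^sup>2 - 3 * z\<^sup>2\<bar> \<le> 3 * (a\<^sup>2 + z\<^sup>2)" by (simp add: abs_le_iff)
    then have "4 * a * \<bar>a\<^sup>2 - 3 * z\<^sup>2\<bar> \<le> 4 * a * (3 * (a\<^sup>2 + z\<^sup>2))"
      using ab by (intro mult_left_mono) auto
    then have "\<bar>c' z\<bar> \<le> 4 * a * (3 * (a\<^sup>2 + z\<^sup>2)) / (a\<^sup>2 + z\<^sup>2) ^ 3"
      using ab sq[of z] by (simp add: c'_def abs_mult divide_right_mono)
    also have "\<dots> = 12 * a / (a\<^sup>2 + z\<^sup>2)\<^sup>2"
    proof -
      have "4 * a * (3 * r) / r ^ 3 = 12 * a / r\<^sup>2" if "r > 0" for r :: real
        using that by (simp add: power2_eq_square power3_eq_cube)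
      from this[OF sq] show ?thesis .
    qed
    also have "\<dots> \<le> 12 * a / (a\<^sup>2 + b\<^sup>2)\<^sup>2"
      using ab z sq[of b] by (intro divide_left_mono power_mono add_left_mono mult_pos_pos zero_less_power sq) auto
    finally show ?thesis by simp
  qed
  also have "\<dots> \<le> 12 * (decay i * decay l)"
    unfolding decay_def a_def b_def by (intro mult_left_mono linear_over_quartic_le) auto
  finally have "\<bar>pi * c' z\<bar> \<le> pi * (12 * (decay i * decay l))"
    unfolding abs_mult by (intro mult_mono) auto
  moreover have "coef i l - coef i (Suc l) = - (pi * c' z)"
  proof -
    have "freq (Suc l) = b + pi" by (simp add: b_def freq_def field_simps)
    then have "coef i l = c b" "coef i (Suc l) = c (b + pi)"
      by (simp_all add: coef_def c_def a_def b_def)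
    then show ?thesis using z(3) by simp
  qed
  ultimately show ?thesis by (simp add: algebra_simps)
qed

lemma row_tail_bound:
  assumes B: "\<And>n. \<bar>\<Sum>l<n. sine_mode l y\<bar> \<le> B" and y: "\<bar>y\<bar> < 1"
  shows "\<bar>profile i y - (\<Sum>l<N. coef i l * sine_mode l y)\<bar>
         \<le> 24 * pi * B * decay i * (\<Sum>l. decay (l + N))"
proof -
  note expansion = profile_sine_expansion[OF y, of i]
  have sm: "summable (\<lambda>l. coef i l * sine_mode l y)" using expansion by (rule sums_summable)
  have tail: "profile i y - (\<Sum>l<N. coef i l * sine_mode l y) = (\<Sum>l. coef i (l + N) * sine_mode (l + N) y)"
    using suminf_split_initial_segment[OF sm, of N] sums_unique[OF expansion] by simp
  \<comment> \<open>a block of sines is a difference of two partial sums\<close>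
  have partial: "\<bar>\<Sum>l<n. sine_mode (l + N) y\<bar> \<le> 2 * B" for n
  proof -
    have "(\<Sum>l<n. sine_mode (l + N) y) = (\<Sum>l<N + n. sine_mode l y) - (\<Sum>l<N. sine_mode l y)"
      by (induction n) (simp_all add: add.commute)
    then show ?thesis using B[of "N + n"] B[of N] by linarith
  qed
  have sd: "summable (\<lambda>l. decay (l + N))" using summable_decay by (rule summable_ignore_initial_segment)
  have vle: "\<bar>coef i (l + N) - coef i (Suc l + N)\<bar> \<le> 12 * pi * decay i * decay (l + N)" for l
    using coef_variation_bound[of i "l + N"] by simp
  have sv: "summable (\<lambda>l. \<bar>coef i (l + N) - coef i (Suc l + N)\<bar>)"
    by (rule summable_comparison_test'[OF summable_mult[OF sd]]) (use vle in simp)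
  have lim: "(\<lambda>l. coef i (l + N)) \<longlonglongrightarrow> 0"
  proof (rule LIMSEQ_ignore_initial_segment, rule summable_LIMSEQ_zero, rule summable_comparison_test')
    show "summable (\<lambda>l. 4 * freq i * inverse (real (Suc l) ^ 2))"
      by (intro summable_mult summable_inverse_Suc_squares)
    show "norm (coef i l) \<le> 4 * freq i * inverse (real (Suc l) ^ 2)" for l
      using coef_bound by simp
  qed
  have "\<bar>\<Sum>l. coef i (l + N) * sine_mode (l + N) y\<bar> \<le> 2 * B * (\<Sum>l. \<bar>coef i (l + N) - coef i (Suc l + N)\<bar>)"
    by (rule abel_bound[OF partial lim summable_sums[OF sv] summable_ignore_initial_segment[OF sm]])
  also have "\<dots> \<le> 2 * B * (12 * pi * decay i * (\<Sum>l. decay (l + N)))"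
    unfolding suminf_mult[OF sd, symmetric]
    using B[of 0] by (intro mult_left_mono suminf_le vle sv summable_mult sd) auto
  finally show ?thesis unfolding tail by (simp add: algebra_simps)
qed

text \<open>
  A rectangular sum with \<open>M\<close> rows differs from the partial sum of \<open>M\<close> terms of \<^const>\<open>half_solution\<close> by the
  row tails. Their sum tends to zero with the number of columns, uniformly in \<open>M\<close>.
\<close>

lemma rectangular_sums_tendsto:
  assumes x: "\<bar>x\<bar> < 1" and y: "\<bar>y\<bar> < 1"
  shows "((\<lambda>(M, N). \<Sum>i<M. \<Sum>l<N. coef i l * sine_mode i x * sine_mode l y) \<longlongrightarrow> half_solution (x, y))
           (sequentially \<times>\<^sub>F sequentially)"
proof -
  define B where "B = 1 / cos (pi * y / 2)"
  have B: "\<bar>\<Sum>l<n. sine_mode l y\<bar> \<le> B" for n unfolding B_def by (rule sum_sine_mode_bound[OF y])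
  define \<tau> where "\<tau> N = (\<Sum>l. decay (l + N))" for N
  define A where "A M = (\<Sum>i<M. sine_mode i x * profile i y)" for M
  define T where "T = (\<lambda>(M, N). \<Sum>i<M. \<Sum>l<N. coef i l * sine_mode i x * sine_mode l y)"
  define K where "K = 24 * pi * B * (\<Sum>i. decay i)"
  have "summable (\<lambda>i. sine_mode i x * profile i y)"
    using x y by (intro summable_product_series tempered_sine_mode decaying_profile) auto
  then have "A \<longlonglongrightarrow> half_solution (x, y)"
    unfolding A_def half_solution_def product_series_def prod.case by (rule summable_LIMSEQ)
  then have A: "((\<lambda>p. A (fst p)) \<longlongrightarrow> half_solution (x, y)) (sequentially \<times>\<^sub>F sequentially)"
    by (rule filterlim_compose[OF _ filterlim_fst])
  have "(\<lambda>N. K * \<tau> N) \<longlonglongrightarrow> K * 0"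
    unfolding \<tau>_def by (intro tendsto_mult tendsto_const suminf_exist_split2 summable_decay)
  then have "(\<lambda>N. K * \<tau> N) \<longlonglongrightarrow> 0" by simp
  then have \<tau>: "((\<lambda>p. K * \<tau> (snd p)) \<longlongrightarrow> 0) (sequentially \<times>\<^sub>F sequentially)"
    by (rule filterlim_compose[OF _ filterlim_snd])
  have "norm (A (fst p) - T p) \<le> K * \<tau> (snd p)" for p
  proof -
    obtain M N where p: "p = (M, N)" by fastforce
    have "\<tau> N \<ge> 0" unfolding \<tau>_def
      by (intro suminf_nonneg summable_ignore_initial_segment summable_decay decay_nonneg)
    have "A M - T (M, N) = (\<Sum>i<M. sine_mode i x * (profile i y - (\<Sum>l<N. coef i l * sine_mode l y)))"
      by (simp add: A_def T_def sum_subtractf[symmetric] right_diff_distrib sum_distrib_left algebra_simps)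
    also have "\<bar>\<dots>\<bar> \<le> (\<Sum>i<M. 24 * pi * B * decay i * \<tau> N)"
    proof (rule order_trans[OF sum_abs sum_mono])
      fix i
      have "\<bar>sine_mode i x * (profile i y - (\<Sum>l<N. coef i l * sine_mode l y))\<bar>
          \<le> 1 * (24 * pi * B * decay i * \<tau> N)"
        unfolding abs_mult \<tau>_def by (intro mult_mono row_tail_bound[OF B y]) (auto simp: sine_mode_def)
      then show "\<bar>sine_mode i x * (profile i y - (\<Sum>l<N. coef i l * sine_mode l y))\<bar> \<le> 24 * pi * B * decay i * \<tau> N"
        by simp
    qed
    also have "\<dots> = 24 * pi * B * (\<Sum>i<M. decay i) * \<tau> N"
      by (simp add: sum_distrib_left sum_distrib_right)
    also have "\<dots> \<le> K * \<tau> N"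
      unfolding K_def using B[of 0] \<open>\<tau> N \<ge> 0\<close>
      by (intro mult_right_mono mult_left_mono sum_le_suminf summable_decay) (auto simp: decay_nonneg)
    finally show ?thesis by (simp add: p)
  qed
  then have "((\<lambda>p. A (fst p) - T p) \<longlongrightarrow> 0) (sequentially \<times>\<^sub>F sequentially)"
    by (intro Lim_null_comparison[OF always_eventually \<tau>]) auto
  from tendsto_diff[OF A this] show ?thesis by (simp add: T_def)
qed

section \<open>The double sine series and the value at the origin\<close>

lemma coef_commute: "coef i l = coef l i"
  by (simp add: coef_def add.commute mult_ac)

lemma h0_term_eq:
  "h0_term s x y (2 * i + 1) (2 * j + 1) = s / 3 * (coef i j * sine_mode i x * sine_mode j y)"
proof -
  define m n where "m = real (2 * i + 1)" and "n = real (2 * j + 1)"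
  have fr: "freq i = m * (pi / 2)" "freq j = n * (pi / 2)" by (simp_all add: freq_def m_def n_def)
  define Q where "Q = m\<^sup>2 + n\<^sup>2"
  have "Q > 0" by (simp add: Q_def m_def add_pos_nonneg)
  have "(freq i)\<^sup>2 + (freq j)\<^sup>2 = Q * (pi / 2)\<^sup>2"
    unfolding fr Q_def by (simp add: power_mult_distrib power_divide distrib_right add_divide_distrib)
  then have "coef i j = 4 * (m * (pi / 2)) * (n * (pi / 2)) / (Q * (pi / 2)\<^sup>2)\<^sup>2"
    unfolding coef_def by (simp add: fr)
  also have "\<dots> = 16 * m * n / (pi\<^sup>2 * Q\<^sup>2)"
    using \<open>Q > 0\<close> by (simp add: power2_eq_square field_simps)
  finally have c: "coef i j = 16 * m * n / (pi\<^sup>2 * (m\<^sup>2 + n\<^sup>2)\<^sup>2)" by (simp only: Q_def)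
  have S: "sin (m * pi * (x + 1) / 2) = sine_mode i x" "sin (n * pi * (y + 1) / 2) = sine_mode j y"
    by (simp_all add: sine_mode_def fr)
  show ?thesis
    unfolding h0_term_def m_def[symmetric] n_def[symmetric] S c by simp
qed

text \<open>
  By the symmetry of the coefficients, exchanging the two summation indices turns the double series at \<open>(y, x)\<close>
  into the one at \<open>(x, y)\<close>, so this one series converges to both halves of the solution. On the sides every
  term vanishes.
\<close>

lemma double_sums_solution:
  assumes "\<bar>x\<bar> \<le> 1" "\<bar>y\<bar> \<le> 1"
  shows "double_sums (\<lambda>i j. h0_term s x y (2 * i + 1) (2 * j + 1)) (solution s (x, y))"
proof (cases "\<bar>x\<bar> = 1 \<or> \<bar>y\<bar> = 1")
  case True
  then have "h0_term s x y (2 * i + 1) (2 * j + 1) = 0" for i j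
    unfolding h0_term_eq using sine_mode_edge by auto
  moreover have "solution s (x, y) = 0"
    using True half_solution_edge by (auto simp: solution_def)
  ultimately show ?thesis by (simp add: double_sums_def case_prod_unfold)
next
  case False
  with assms have xy: "\<bar>x\<bar> < 1" "\<bar>y\<bar> < 1" by auto
  define P where "P u v = (\<lambda>(M, N). \<Sum>i<M. \<Sum>l<N. coef i l * sine_mode i u * sine_mode l v)" for u v
  have P: "(P x y \<longlongrightarrow> half_solution (x, y)) (sequentially \<times>\<^sub>F sequentially)"
    "(P y x \<longlongrightarrow> half_solution (y, x)) (sequentially \<times>\<^sub>F sequentially)"
    unfolding P_def using xy by (auto intro: rectangular_sums_tendsto)
  have "filterlim prod.swap (sequentially \<times>\<^sub>F sequentially) (sequentially \<times>\<^sub>F sequentially)"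
    using prod_filter_commute[of sequentially sequentially] unfolding filterlim_def by simp
  from filterlim_compose[OF P(2) this]
  have "((\<lambda>p. P y x (prod.swap p)) \<longlongrightarrow> half_solution (y, x)) (sequentially \<times>\<^sub>F sequentially)" .
  moreover have "P y x (prod.swap p) = P x y p" for p
  proof -
    have "(\<Sum>i<N. \<Sum>l<M. coef i l * sine_mode i y * sine_mode l x)
        = (\<Sum>l<M. \<Sum>i<N. coef l i * sine_mode l x * sine_mode i y)" for M N
      by (subst sum.swap) (simp add: coef_commute mult_ac)
    then show ?thesis by (cases p) (simp add: P_def)
  qed
  ultimately have "(P x y \<longlongrightarrow> half_solution (y, x)) (sequentially \<times>\<^sub>F sequentially)" by simp
  from tendsto_mult[OF tendsto_const[of "s / 6"] tendsto_add[OF P(1) this]]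
  have "((\<lambda>p. s / 6 * (P x y p + P x y p)) \<longlongrightarrow> solution s (x, y)) (sequentially \<times>\<^sub>F sequentially)"
    by (simp add: solution_def)
  moreover have "s / 6 * (P x y p + P x y p) = (\<lambda>(M, N). \<Sum>i<M. \<Sum>j<N. h0_term s x y (2 * i + 1) (2 * j + 1)) p" for p
  proof -
    have "s / 6 * (P x y p + P x y p) = s / 3 * P x y p" by simp
    then show ?thesis
      unfolding h0_term_eq by (cases p) (simp only: P_def prod.case sum_distrib_left)
  qed
  ultimately show ?thesis by (simp add: double_sums_def)
qed

text \<open>
  Since \<open>a\<^sub>j\<^sub>+\<^sub>1 = a\<^sub>j + \<pi>\<close>, passing to the next index multiplies \<open>cosh\<close> by at least \<open>cosh \<pi> > 2\<close>, whereas \<open>tanh a\<^sub>j\<close> is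
  already at least \<open>1 / 2\<close>. So the terms of the alternating series decrease, and grouping them in pairs gives a
  series of positive terms.
\<close>

lemma solution_origin_pos:
  assumes "s > 0"
  shows "solution s (0, 0) > 0"
proof -
  define f where "f j = tanh (freq j) / cosh (freq j)" for j
  have decreasing: "f (Suc j) < f j" for j
  proof -
    have "freq (Suc j) = freq j + pi" by (simp add: freq_def field_simps)
    then have "cosh (freq j) * cosh pi \<le> cosh (freq (Suc j))" by (simp add: cosh_add)
    moreover have "2 < cosh pi"
    proof -
      have "4 < exp pi" using exp_ge_add_one_self[of pi] pi_gt3 by linarith
      then show ?thesis using exp_gt_zero[of "- pi"] by (simp add: cosh_def del: exp_gt_zero)
    qed
    then have "cosh (freq j) * 2 < cosh (freq j) * cosh pi" by (intro mult_strict_left_mono) auto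
    ultimately have c: "2 * cosh (freq j) < cosh (freq (Suc j))" by linarith
    have "1 \<le> 2 * tanh (freq j)"
    proof -
      have "3 \<le> exp (2 * freq j)"
        using exp_ge_add_one_self[of "2 * freq j"] freq_gt_1[of j] by linarith
      then have "3 * exp (- freq j) \<le> exp (2 * freq j) * exp (- freq j)" by (intro mult_right_mono) auto
      then have "3 * exp (- freq j) \<le> exp (freq j)" by (simp add: exp_add[symmetric])
      then have "cosh (freq j) \<le> 2 * sinh (freq j)" by (simp add: cosh_def sinh_def)
      then show ?thesis by (simp add: tanh_def)
    qed
    have "f (Suc j) \<le> 1 / cosh (freq (Suc j))"
      using abs_tanh_le_1[of "freq (Suc j)"] by (simp add: f_def divide_right_mono abs_le_iff)
    also have "\<dots> < 1 / (2 * cosh (freq j))"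
      using c by (intro divide_strict_left_mono) auto
    also have "\<dots> \<le> f j"
      using \<open>1 \<le> 2 * tanh (freq j)\<close> by (simp add: f_def field_simps)
    finally show ?thesis .
  qed
  have sine: "sine_mode j 0 = (- 1) ^ j" for j
  proof -
    have "freq j = real j * pi + pi / 2" by (simp add: freq_def field_simps)
    then show ?thesis by (simp add: sine_mode_def sin_add cos_npi)
  qed
  have profile: "profile j 0 = f j" for j
    by (simp add: profile_def cosh_ratio_def f_def)
  have "summable (\<lambda>j. sine_mode j 0 * profile j 0)"
    by (intro summable_product_series tempered_sine_mode decaying_profile) auto
  then have "(\<lambda>j. (- 1) ^ j * f j) sums half_solution (0, 0)"
    unfolding half_solution_def product_series_def prod.case sine profile by (rule summable_sums)
  moreover have "(\<Sum>j\<in>{n * 2..<n * 2 + 2}. (- 1) ^ j * f j) = f (2 * n) - f (Suc (2 * n))" for n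
  proof -
    have "{n * 2..<n * 2 + 2} = {2 * n, Suc (2 * n)}" by auto
    then show ?thesis by simp
  qed
  ultimately have pairs: "(\<lambda>n. f (2 * n) - f (Suc (2 * n))) sums half_solution (0, 0)"
    using sums_group[of "\<lambda>j. (- 1) ^ j * f j" "half_solution (0, 0)" 2] by simp
  have "half_solution (0, 0) > 0"
    using suminf_pos[OF sums_summable[OF pairs]] decreasing sums_unique[OF pairs] by simp
  then show ?thesis using assms by (simp add: solution_def)
qed

theorem proposition4p1:
  fixes s_plus :: real
  assumes "s_plus > 0"
  shows "(\<exists>h. is_h0 s_plus h) \<and>
         (\<forall>h. is_h0 s_plus h \<longrightarrow>
            (\<forall>(x, y) \<in> closure Omega - corners.
               double_sums (\<lambda>i j. h0_term s_plus x y (2 * i + 1) (2 * j + 1)) (h (x, y)))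
            \<and> h (0, 0) > 0)"
proof (intro conjI exI allI impI)
  show "is_h0 s_plus (solution s_plus)" by (rule is_h0_solution)
  fix h assume h: "is_h0 s_plus h"
  show "\<forall>(x, y) \<in> closure Omega - corners.
      double_sums (\<lambda>i j. h0_term s_plus x y (2 * i + 1) (2 * j + 1)) (h (x, y))"
  proof clarify
    fix x y assume p: "(x, y) \<in> closure Omega" "(x, y) \<notin> corners"
    then have "\<bar>x\<bar> \<le> 1" "\<bar>y\<bar> \<le> 1" by (auto simp: closure_Omega)
    then show "double_sums (\<lambda>i j. h0_term s_plus x y (2 * i + 1) (2 * j + 1)) (h (x, y))"
      using double_sums_solution is_h0_unique[OF h, of "(x, y)"] p by simp
  qed
  have "(0, 0) \<in> closure Omega - corners" by (auto simp: closure_Omega corners_def)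
  then show "h (0, 0) > 0"
    using is_h0_unique[OF h] solution_origin_pos[OF assms] by simp
qed

end
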